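(* Let $(M,\omega)$ be a closed symplectic manifold with $[\omega]\in H^2(M;\mathbb{Z})$, let $(P,\xi=\ker\alpha)$ be a prequantization of $(M,\omega)$ with bundle projection $\pi:P\to M$, and let $\Lambda \subset M$ be a submanifold. Then $\Lambda$ is a symplectic coisotropic submanifold of $M$ if and only if $\pi^{-1}(\Lambda)$ is a contact coisotropic submanifold of $P$.
   Context: A prequantization of $(M,\omega)$ is a principal $S^1$-bundle $\pi:P\to M$ with a contact structure $\xi=\ker\alpha$ on $P$, where $\alpha$ is a connection form with $d\alpha=\pi^*\omega$; thus $T_aP=\xi_a\oplus V_a$ with $V_a$ the vertical subspace tangent to the $S^1$-fibre, and $d\pi$ identifies $\xi_a$ with $T_{\pi(a)}M$. A submanifold $Y\subset P$ is contact coisotropic if for every $a\in Y$, $(T_aY\cap\xi_a)^{\perp_{d\alpha}}\subset T_aY\cap \xi_a$, where $\perp_{d\alpha}$ denotes the symplectic orthogonal complement inside $\xi_a$ with respect to $d\alpha|_{\xi}$. A submanifold $\Lambda$ of $(M,\omega)$ is symplectic coisotropic if $(T_x\Lambda)^{\perp_\omega}\subset T_x\Lambda$ for all $x\in\Lambda$. *)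

theory Defs
  imports "HOL-Analysis.Analysis" "HOL-Homology.Homology"
begin

section \<open>Smooth maps between open sets of Euclidean spaces\<close>

(* Only meant for open S: derivatives are taken at x, not within S. *)
fun Ck_on :: "nat \<Rightarrow> 'a::euclidean_space set \<Rightarrow> ('a \<Rightarrow> 'b::real_normed_vector) \<Rightarrow> bool" where
  "Ck_on 0 S f \<longleftrightarrow> continuous_on S f"
| "Ck_on (Suc k) S f \<longleftrightarrow>
     (\<forall>x\<in>S. f differentiable (at x)) \<and> (\<forall>v. Ck_on k S (\<lambda>x. frechet_derivative f (at x) v))"

definition smooth_on :: "'a::euclidean_space set \<Rightarrow> ('a \<Rightarrow> 'b::real_normed_vector) \<Rightarrow> bool" where
  "smooth_on S f \<longleftrightarrow> (\<forall>k. Ck_on k S f)"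


section \<open>Smooth manifolds\<close>

text \<open>A chart is a pair of its domain and its coordinate map; only the values of the coordinate
  map on the domain are meaningful. The atlas of a manifold need not be maximal.\<close>

type_synonym ('m, 'e) chart = "'m set \<times> ('m \<Rightarrow> 'e)"

record ('m, 'e) mfd =
  mtop :: "'m topology"
  atlas :: "('m, 'e) chart set"

abbreviation points :: "('m, 'e) mfd \<Rightarrow> 'm set" where
  "points M \<equiv> topspace (mtop M)"

abbreviation chart_inv :: "('m, 'e) chart \<Rightarrow> 'e \<Rightarrow> 'm" where
  "chart_inv c \<equiv> inv_into (fst c) (snd c)"

definition is_chart :: "'m topology \<Rightarrow> ('m, 'e::euclidean_space) chart \<Rightarrow> bool" where
  "is_chart X c \<longleftrightarrow> openin X (fst c) \<and> open (snd c ` fst c) \<and>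
     homeomorphic_map (subtopology X (fst c)) (top_of_set (snd c ` fst c)) (snd c)"

definition transition :: "('m, 'e) chart \<Rightarrow> ('m, 'e) chart \<Rightarrow> 'e \<Rightarrow> 'e" where
  "transition c d = snd d \<circ> chart_inv c"

definition compatible :: "('m, 'e::euclidean_space) chart \<Rightarrow> ('m, 'e) chart \<Rightarrow> bool" where
  "compatible c d \<longleftrightarrow> smooth_on (snd c ` (fst c \<inter> fst d)) (transition c d) \<and>
                     smooth_on (snd d ` (fst c \<inter> fst d)) (transition d c)"

definition smooth_manifold :: "('m, 'e::euclidean_space) mfd \<Rightarrow> bool" where
  "smooth_manifold M \<longleftrightarrow>
     Hausdorff_space (mtop M) \<and> second_countable (mtop M) \<and>
     (\<forall>c\<in>atlas M. is_chart (mtop M) c) \<and>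
     (\<Union>c\<in>atlas M. fst c) = points M \<and>
     (\<forall>c\<in>atlas M. \<forall>d\<in>atlas M. compatible c d)"

definition closed_manifold :: "('m, 'e::euclidean_space) mfd \<Rightarrow> bool" where
  "closed_manifold M \<longleftrightarrow> smooth_manifold M \<and> compact_space (mtop M)"

definition maximal_atlas :: "('m, 'e::euclidean_space) mfd \<Rightarrow> ('m, 'e) chart set" where
  "maximal_atlas M = {c. is_chart (mtop M) c \<and> (\<forall>d\<in>atlas M. compatible c d)}"

definition charts_at :: "('m, 'e) mfd \<Rightarrow> 'm \<Rightarrow> ('m, 'e) chart set" where
  "charts_at M p = {c \<in> atlas M. p \<in> fst c}"

definition chart_at :: "('m, 'e) mfd \<Rightarrow> 'm \<Rightarrow> ('m, 'e) chart" where
  "chart_at M p = (SOME c. c \<in> charts_at M p)"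

definition smooth_map ::
    "('m, 'e::euclidean_space) mfd \<Rightarrow> ('n, 'f::euclidean_space) mfd \<Rightarrow> ('m \<Rightarrow> 'n) \<Rightarrow> bool" where
  "smooth_map M N f \<longleftrightarrow> continuous_map (mtop M) (mtop N) f \<and>
     (\<forall>c\<in>atlas M. \<forall>d\<in>atlas N.
        smooth_on (snd c ` {p \<in> fst c. f p \<in> fst d}) (snd d \<circ> f \<circ> chart_inv c))"

definition diffeomorphism ::
    "('m, 'e::euclidean_space) mfd \<Rightarrow> ('n, 'f::euclidean_space) mfd \<Rightarrow> ('m \<Rightarrow> 'n) \<Rightarrow> bool" where
  "diffeomorphism M N f \<longleftrightarrow> smooth_map M N f \<and>
     (\<exists>g. smooth_map N M g \<and> (\<forall>x\<in>points M. g (f x) = x) \<and> (\<forall>y\<in>points N. f (g y) = y))"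

definition open_submfd :: "('m, 'e) mfd \<Rightarrow> 'm set \<Rightarrow> ('m, 'e) mfd" where
  "open_submfd M U =
     \<lparr>mtop = subtopology (mtop M) U, atlas = (\<lambda>c. (fst c \<inter> U, snd c)) ` atlas M\<rparr>"

definition prod_mfd :: "('m, 'e) mfd \<Rightarrow> ('n, 'f) mfd \<Rightarrow> ('m \<times> 'n, 'e \<times> 'f) mfd" where
  "prod_mfd M N = \<lparr>mtop = prod_topology (mtop M) (mtop N),
     atlas = {(fst c \<times> fst d, map_prod (snd c) (snd d)) | c d. c \<in> atlas M \<and> d \<in> atlas N}\<rparr>"

definition open_euclidean :: "'e::euclidean_space set \<Rightarrow> ('e, 'e) mfd" where
  "open_euclidean W = \<lparr>mtop = top_of_set W, atlas = {(W, id)}\<rparr>"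

abbreviation circle :: "complex set" where
  "circle \<equiv> sphere 0 1"

(* The chart centred at w is the angle measured from w, with values in the interval (-pi, pi). *)
definition circle_mfd :: "(complex, real) mfd" where
  "circle_mfd = \<lparr>mtop = top_of_set circle,
     atlas = {(circle - {- w}, \<lambda>z. Arg (z / w)) | w. w \<in> circle}\<rparr>"

definition submanifold :: "('m, 'e::euclidean_space) mfd \<Rightarrow> 'm set \<Rightarrow> bool" where
  "submanifold M Y \<longleftrightarrow> Y \<subseteq> points M \<and>
     (\<exists>k. \<forall>x\<in>Y. \<exists>c\<in>maximal_atlas M. \<exists>S. x \<in> fst c \<and> subspace S \<and> dim S = k \<and>
        snd c ` (fst c \<inter> Y) = snd c ` fst c \<inter> S)"


section \<open>Tangent vectors and differentials\<close>

text \<open>A tangent vector at a point is the family of its coordinate vectors in all charts of the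
  atlas around that point, related by the derivatives of the transition maps. Entries for all
  other charts are set to zero, so that equality of tangent vectors is equality of functions.
  Vector space operations are pointwise.\<close>

type_synonym ('m, 'e) tvec = "('m, 'e) chart \<Rightarrow> 'e"

definition tangent_space :: "('m, 'e::euclidean_space) mfd \<Rightarrow> 'm \<Rightarrow> ('m, 'e) tvec set" where
  "tangent_space M p = {v.
     (\<forall>c\<in>charts_at M p. \<forall>d\<in>charts_at M p.
        v d = frechet_derivative (transition c d) (at (snd c p)) (v c)) \<and>
     (\<forall>c. c \<notin> charts_at M p \<longrightarrow> v c = 0)}"

abbreviation tv_zero :: "('m, 'e::euclidean_space) tvec" where
  "tv_zero \<equiv> (\<lambda>c. 0)"

abbreviation tv_comb ::
    "real \<Rightarrow> ('m, 'e::euclidean_space) tvec \<Rightarrow> real \<Rightarrow> ('m, 'e) tvec \<Rightarrow> ('m, 'e) tvec" where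
  "tv_comb r v s w \<equiv> (\<lambda>c. r *\<^sub>R v c + s *\<^sub>R w c)"

text \<open>The tangent vector at \<open>p\<close> whose coordinate vector in the chart \<open>c\<close> around \<open>p\<close> is \<open>u\<close>.\<close>

definition coord_vec ::
    "('m, 'e::euclidean_space) mfd \<Rightarrow> ('m, 'e) chart \<Rightarrow> 'm \<Rightarrow> 'e \<Rightarrow> ('m, 'e) tvec" where
  "coord_vec M c p u =
     (\<lambda>d. if d \<in> charts_at M p then frechet_derivative (transition c d) (at (snd c p)) u else 0)"

definition velocity ::
    "('m, 'e::euclidean_space) mfd \<Rightarrow> (real \<Rightarrow> 'm) \<Rightarrow> real \<Rightarrow> ('m, 'e) tvec" where
  "velocity M \<gamma> t =
     (\<lambda>d. if d \<in> charts_at M (\<gamma> t) then vector_derivative (snd d \<circ> \<gamma>) (at t) else 0)"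

(* By the chain rule the result does not depend on the chart chosen around p. *)
definition differential ::
    "('m, 'e::euclidean_space) mfd \<Rightarrow> ('n, 'f::euclidean_space) mfd \<Rightarrow> ('m \<Rightarrow> 'n) \<Rightarrow>
     'm \<Rightarrow> ('m, 'e) tvec \<Rightarrow> ('n, 'f) tvec" where
  "differential M N f p v = (let c = chart_at M p in
     (\<lambda>d. if d \<in> charts_at N (f p)
          then frechet_derivative (snd d \<circ> f \<circ> chart_inv c) (at (snd c p)) (v c) else 0))"

text \<open>The tangent space of a submanifold, as a subset of the ambient tangent space: velocities of
  smooth curves that run in the submanifold.\<close>

definition tangent_of :: "('m, 'e::euclidean_space) mfd \<Rightarrow> 'm set \<Rightarrow> 'm \<Rightarrow> ('m, 'e) tvec set" where
  "tangent_of M Y a = {velocity M \<gamma> 0 | \<gamma> \<epsilon>. 0 < \<epsilon> \<and>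
     smooth_map (open_euclidean {-\<epsilon><..<\<epsilon>}) M \<gamma> \<and> \<gamma> ` {-\<epsilon><..<\<epsilon>} \<subseteq> Y \<and> \<gamma> 0 = a}"


section \<open>Differential forms of degree one and two\<close>

text \<open>The value of a form at a point matters only on tangent vectors at that point.\<close>

type_synonym ('m, 'e) form1 = "'m \<Rightarrow> ('m, 'e) tvec \<Rightarrow> real"
type_synonym ('m, 'e) form2 = "'m \<Rightarrow> ('m, 'e) tvec \<Rightarrow> ('m, 'e) tvec \<Rightarrow> real"

definition local1 ::
    "('m, 'e::euclidean_space) mfd \<Rightarrow> ('m, 'e) form1 \<Rightarrow> ('m, 'e) chart \<Rightarrow> 'e \<Rightarrow> 'e \<Rightarrow> real" where
  "local1 M \<alpha> c y u = (let p = chart_inv c y in \<alpha> p (coord_vec M c p u))"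

definition local2 ::
    "('m, 'e::euclidean_space) mfd \<Rightarrow> ('m, 'e) form2 \<Rightarrow> ('m, 'e) chart \<Rightarrow> 'e \<Rightarrow> 'e \<Rightarrow> 'e \<Rightarrow> real" where
  "local2 M \<omega> c y u v = (let p = chart_inv c y in \<omega> p (coord_vec M c p u) (coord_vec M c p v))"

definition smooth_form1 :: "('m, 'e::euclidean_space) mfd \<Rightarrow> ('m, 'e) form1 \<Rightarrow> bool" where
  "smooth_form1 M \<alpha> \<longleftrightarrow>
     (\<forall>p\<in>points M. \<forall>v\<in>tangent_space M p. \<forall>w\<in>tangent_space M p. \<forall>r s.
        \<alpha> p (tv_comb r v s w) = r * \<alpha> p v + s * \<alpha> p w) \<and>
     (\<forall>c\<in>atlas M. \<forall>u. smooth_on (snd c ` fst c) (\<lambda>y. local1 M \<alpha> c y u))"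

definition smooth_form2 :: "('m, 'e::euclidean_space) mfd \<Rightarrow> ('m, 'e) form2 \<Rightarrow> bool" where
  "smooth_form2 M \<omega> \<longleftrightarrow>
     (\<forall>p\<in>points M. \<forall>u\<in>tangent_space M p. \<forall>v\<in>tangent_space M p. \<forall>w\<in>tangent_space M p. \<forall>r s.
        \<omega> p (tv_comb r u s v) w = r * \<omega> p u w + s * \<omega> p v w \<and>
        \<omega> p w (tv_comb r u s v) = r * \<omega> p w u + s * \<omega> p w v) \<and>
     (\<forall>p\<in>points M. \<forall>v\<in>tangent_space M p. \<omega> p v v = 0) \<and>
     (\<forall>c\<in>atlas M. \<forall>u v. smooth_on (snd c ` fst c) (\<lambda>y. local2 M \<omega> c y u v))"

(* Local coordinate formula, (d alpha)(v, w) = v(alpha(w)) - w(alpha(v)) for vector fields v and w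
   with constant coefficients; for a smooth form it does not depend on the chart. *)
definition ext_deriv1 :: "('m, 'e::euclidean_space) mfd \<Rightarrow> ('m, 'e) form1 \<Rightarrow> ('m, 'e) form2" where
  "ext_deriv1 M \<alpha> p v w = (let c = chart_at M p in
     frechet_derivative (\<lambda>y. local1 M \<alpha> c y (w c)) (at (snd c p)) (v c) -
     frechet_derivative (\<lambda>y. local1 M \<alpha> c y (v c)) (at (snd c p)) (w c))"

(* d omega = 0, by the analogous coordinate formula in every chart. *)
definition closed_form2 :: "('m, 'e::euclidean_space) mfd \<Rightarrow> ('m, 'e) form2 \<Rightarrow> bool" where
  "closed_form2 M \<omega> \<longleftrightarrow> (\<forall>c\<in>atlas M. \<forall>y\<in>snd c ` fst c. \<forall>u v w.
     frechet_derivative (\<lambda>y. local2 M \<omega> c y v w) (at y) u -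
     frechet_derivative (\<lambda>y. local2 M \<omega> c y u w) (at y) v +
     frechet_derivative (\<lambda>y. local2 M \<omega> c y u v) (at y) w = 0)"

definition nondegenerate_on :: "('m, 'e::euclidean_space) tvec set \<Rightarrow>
    (('m, 'e) tvec \<Rightarrow> ('m, 'e) tvec \<Rightarrow> real) \<Rightarrow> bool" where
  "nondegenerate_on E \<beta> \<longleftrightarrow> (\<forall>v\<in>E. (\<forall>w\<in>E. \<beta> v w = 0) \<longrightarrow> v = tv_zero)"

definition symplectic_form :: "('m, 'e::euclidean_space) mfd \<Rightarrow> ('m, 'e) form2 \<Rightarrow> bool" where
  "symplectic_form M \<omega> \<longleftrightarrow> smooth_form2 M \<omega> \<and> closed_form2 M \<omega> \<and>
     (\<forall>p\<in>points M. nondegenerate_on (tangent_space M p) (\<omega> p))"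


section \<open>Integral cohomology classes\<close>

definition triangle :: "(real \<times> real) set" where
  "triangle = {(s, t). 0 \<le> s \<and> 0 \<le> t \<and> s + t \<le> 1}"

text \<open>The affine bijection from the triangle onto the standard 2-simplex of HOL-Homology.\<close>

definition bary :: "real \<times> real \<Rightarrow> nat \<Rightarrow> real" where
  "bary = (\<lambda>(s, t) i. if i = 0 then 1 - s - t else if i = 1 then s else if i = 2 then t else 0)"

definition smooth_simplex2 ::
    "('m, 'e::euclidean_space) mfd \<Rightarrow> ((nat \<Rightarrow> real) \<Rightarrow> 'm) \<Rightarrow> bool" where
  "smooth_simplex2 M \<sigma> \<longleftrightarrow> singular_simplex 2 (mtop M) \<sigma> \<and>
     (\<exists>W g. open W \<and> triangle \<subseteq> W \<and> smooth_map (open_euclidean W) M g \<and>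
            (\<forall>q\<in>triangle. \<sigma> (bary q) = g q))"

definition simplex_integral ::
    "('m, 'e::euclidean_space) mfd \<Rightarrow> ('m, 'e) form2 \<Rightarrow> ((nat \<Rightarrow> real) \<Rightarrow> 'm) \<Rightarrow> real" where
  "simplex_integral M \<omega> \<sigma> = integral (interior triangle) (\<lambda>(s, t).
     \<omega> (\<sigma> (bary (s, t))) (velocity M (\<lambda>s'. \<sigma> (bary (s', t))) s)
                         (velocity M (\<lambda>t'. \<sigma> (bary (s, t'))) t))"

definition coboundary ::
    "nat \<Rightarrow> (((nat \<Rightarrow> real) \<Rightarrow> 'm) \<Rightarrow> 'g::comm_ring_1) \<Rightarrow> ((nat \<Rightarrow> real) \<Rightarrow> 'm) \<Rightarrow> 'g" where
  "coboundary p b \<sigma> = (\<Sum>k\<le>p. (- 1) ^ k * b (singular_face p k \<sigma>))"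

text \<open>The de Rham class of the closed 2-form lies in the image of the integral singular cohomology
  in the real one: under the de Rham isomorphism, integration of the form over smooth singular
  simplices is cohomologous to (the restriction of) an integral singular cocycle. A cochain is
  given by its values on singular simplices.\<close>

definition integral_class :: "('m, 'e::euclidean_space) mfd \<Rightarrow> ('m, 'e) form2 \<Rightarrow> bool" where
  "integral_class M \<omega> \<longleftrightarrow>
     (\<exists>(z :: ((nat \<Rightarrow> real) \<Rightarrow> 'm) \<Rightarrow> int) (b :: ((nat \<Rightarrow> real) \<Rightarrow> 'm) \<Rightarrow> real).
        (\<forall>\<tau>. singular_simplex 3 (mtop M) \<tau> \<longrightarrow> coboundary 3 z \<tau> = 0) \<and>
        (\<forall>\<sigma>. smooth_simplex2 M \<sigma> \<longrightarrow>
              simplex_integral M \<omega> \<sigma> = of_int (z \<sigma>) + coboundary 2 b \<sigma>))"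


section \<open>Prequantization\<close>

definition principal_circle_bundle ::
    "('p, 'f::euclidean_space) mfd \<Rightarrow> ('m, 'e::euclidean_space) mfd \<Rightarrow>
     ('p \<Rightarrow> 'm) \<Rightarrow> ('p \<Rightarrow> complex \<Rightarrow> 'p) \<Rightarrow> bool" where
  "principal_circle_bundle P M \<pi> act \<longleftrightarrow>
     smooth_manifold P \<and> smooth_manifold M \<and> smooth_map P M \<pi> \<and>
     smooth_map (prod_mfd P circle_mfd) P (\<lambda>(a, z). act a z) \<and>
     (\<forall>a\<in>points P. act a 1 = a) \<and>
     (\<forall>a\<in>points P. \<forall>z\<in>circle. \<forall>z'\<in>circle. act (act a z) z' = act a (z * z')) \<and>
     (\<forall>a\<in>points P. \<forall>z\<in>circle. \<pi> (act a z) = \<pi> a) \<and>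
     (\<forall>x\<in>points M. \<exists>U \<Phi>. openin (mtop M) U \<and> x \<in> U \<and>
        diffeomorphism (open_submfd P {a \<in> points P. \<pi> a \<in> U})
                       (prod_mfd (open_submfd M U) circle_mfd) \<Phi> \<and>
        (\<forall>a\<in>points P. \<pi> a \<in> U \<longrightarrow> fst (\<Phi> a) = \<pi> a \<and>
           (\<forall>z\<in>circle. snd (\<Phi> (act a z)) = snd (\<Phi> a) * z)))"

text \<open>The circle is identified with \<open>\<real>/\<int>\<close>: the generator of the action has period 1. With this
  normalization the curvature of a connection form represents an integral class.\<close>

definition generator ::
    "('p, 'f::euclidean_space) mfd \<Rightarrow> ('p \<Rightarrow> complex \<Rightarrow> 'p) \<Rightarrow> 'p \<Rightarrow> ('p, 'f) tvec" where
  "generator P act a = velocity P (\<lambda>t. act a (cis (2 * pi * t))) 0"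

definition connection_form ::
    "('p, 'f::euclidean_space) mfd \<Rightarrow> ('p \<Rightarrow> complex \<Rightarrow> 'p) \<Rightarrow> ('p, 'f) form1 \<Rightarrow> bool" where
  "connection_form P act \<alpha> \<longleftrightarrow> smooth_form1 P \<alpha> \<and>
     (\<forall>a\<in>points P. \<alpha> a (generator P act a) = 1) \<and>
     (\<forall>a\<in>points P. \<forall>z\<in>circle. \<forall>v\<in>tangent_space P a.
        \<alpha> (act a z) (differential P P (\<lambda>q. act q z) a v) = \<alpha> a v)"

definition contact_plane ::
    "('p, 'f::euclidean_space) mfd \<Rightarrow> ('p, 'f) form1 \<Rightarrow> 'p \<Rightarrow> ('p, 'f) tvec set" where
  "contact_plane P \<alpha> a = {v \<in> tangent_space P a. \<alpha> a v = 0}"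

definition contact_form :: "('p, 'f::euclidean_space) mfd \<Rightarrow> ('p, 'f) form1 \<Rightarrow> bool" where
  "contact_form P \<alpha> \<longleftrightarrow> smooth_form1 P \<alpha> \<and>
     (\<forall>a\<in>points P. (\<exists>v\<in>tangent_space P a. \<alpha> a v \<noteq> 0) \<and>
        nondegenerate_on (contact_plane P \<alpha> a) (ext_deriv1 P \<alpha> a))"

definition prequantization ::
    "('m, 'e::euclidean_space) mfd \<Rightarrow> ('m, 'e) form2 \<Rightarrow> ('p, 'f::euclidean_space) mfd \<Rightarrow>
     ('p \<Rightarrow> 'm) \<Rightarrow> ('p \<Rightarrow> complex \<Rightarrow> 'p) \<Rightarrow> ('p, 'f) form1 \<Rightarrow> bool" where
  "prequantization M \<omega> P \<pi> act \<alpha> \<longleftrightarrow>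
     principal_circle_bundle P M \<pi> act \<and> connection_form P act \<alpha> \<and> contact_form P \<alpha> \<and>
     (\<forall>a\<in>points P. \<forall>v\<in>tangent_space P a. \<forall>w\<in>tangent_space P a.
        ext_deriv1 P \<alpha> a v w =
          \<omega> (\<pi> a) (differential P M \<pi> a v) (differential P M \<pi> a w))"


section \<open>Coisotropic submanifolds\<close>

definition orth_in :: "('m, 'e) tvec set \<Rightarrow> (('m, 'e) tvec \<Rightarrow> ('m, 'e) tvec \<Rightarrow> real) \<Rightarrow>
    ('m, 'e) tvec set \<Rightarrow> ('m, 'e) tvec set" where
  "orth_in E \<beta> W = {v \<in> E. \<forall>w\<in>W. \<beta> v w = 0}"

definition symplectic_coisotropic ::
    "('m, 'e::euclidean_space) mfd \<Rightarrow> ('m, 'e) form2 \<Rightarrow> 'm set \<Rightarrow> bool" where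
  "symplectic_coisotropic M \<omega> \<Lambda> \<longleftrightarrow> submanifold M \<Lambda> \<and>
     (\<forall>x\<in>\<Lambda>. orth_in (tangent_space M x) (\<omega> x) (tangent_of M \<Lambda> x) \<subseteq> tangent_of M \<Lambda> x)"

definition contact_coisotropic ::
    "('p, 'f::euclidean_space) mfd \<Rightarrow> ('p, 'f) form1 \<Rightarrow> 'p set \<Rightarrow> bool" where
  "contact_coisotropic P \<alpha> Y \<longleftrightarrow> submanifold P Y \<and>
     (\<forall>a\<in>Y. orth_in (contact_plane P \<alpha> a) (ext_deriv1 P \<alpha> a)
                    (tangent_of P Y a \<inter> contact_plane P \<alpha> a)
            \<subseteq> tangent_of P Y a \<inter> contact_plane P \<alpha> a)"

end

theory Submission
  imports Defs
begin

text \<open>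
  Let \<open>Y = \<pi>\<^sup>-\<^sup>1(\<Lambda>)\<close>, \<open>a \<in> Y\<close> and \<open>x = \<pi> a\<close>. The differential \<open>d\<pi>\<close> restricts to a linear isomorphism from the
  contact plane \<open>\<xi>\<^sub>a\<close> onto \<open>T\<^sub>x M\<close>, which takes \<open>d\<alpha>\<close> to \<open>\<omega>\<close> and \<open>T\<^sub>a Y \<inter> \<xi>\<^sub>a\<close> onto \<open>T\<^sub>x \<Lambda>\<close>. Hence it takes the
  \<open>d\<alpha>\<close>-orthogonal complement of \<open>T\<^sub>a Y \<inter> \<xi>\<^sub>a\<close> in \<open>\<xi>\<^sub>a\<close> onto the \<open>\<omega>\<close>-orthogonal complement of \<open>T\<^sub>x \<Lambda>\<close>, and
  one complement lies in its subspace if and only if the other does. Every \<open>x \<in> \<Lambda>\<close> is of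
  the form \<open>\<pi> a\<close>, so the two pointwise conditions are equivalent.

  Injectivity of \<open>d\<pi>\<close> on \<open>\<xi>\<^sub>a\<close> follows from \<open>d\<alpha> = \<pi>\<^sup>*\<omega>\<close> and the nondegeneracy of \<open>d\<alpha>\<close> on \<open>\<xi>\<^sub>a\<close>
  (\<open>differential_inj_on_contact_plane\<close>). Tangent vectors are velocities of curves, so the remaining
  claims on tangent spaces reduce to lifting curves: every curve in \<open>M\<close> through \<open>x\<close> lifts to a curve through
  \<open>a\<close> with velocity in \<open>\<xi>\<^sub>a\<close> (\<open>horizontal_lift\<close>). If the curve runs in \<open>\<Lambda>\<close>, its lift runs in \<open>Y\<close>;
  with injectivity this gives \<open>tangent_of_preimage_iff\<close>, and applied to all curves in \<open>M\<close> it gives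
  surjectivity.

  It must also be shown that \<open>Y\<close> is a submanifold (\<open>submanifold_preimage\<close>). Both this and the lifting
  of curves rest on coordinates of \<open>P\<close> adapted to the bundle (\<open>bundle_local_param\<close>): a chart of \<open>M\<close>
  together with the angle in the fibre, given by a local trivialization.
\<close>


section \<open>Calculus of smooth maps between open sets\<close>

lemma Ck_on_cong_imp:
  assumes "open S" "\<And>x. x \<in> S \<Longrightarrow> f x = g x" "Ck_on k S f"
  shows "Ck_on k S g"
  using assms(2,3)
proof (induction k arbitrary: f g)
  case 0
  then show ?case by (simp cong: continuous_on_cong)
next
  case (Suc k)
  have D: "frechet_derivative f (at x) = frechet_derivative g (at x)" if "x \<in> S" for x
    using Suc.prems that
    by (intro frechet_derivative_transform_within_open[OF _ \<open>open S\<close>]) auto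
  have "g differentiable at x" if "x \<in> S" for x
  proof -
    have "f differentiable at x" using Suc.prems that by auto
    then obtain f' where "(f has_derivative f') (at x)" by (auto simp: differentiable_def)
    then have "(g has_derivative f') (at x)"
      by (rule has_derivative_transform_within_open[OF _ \<open>open S\<close> that Suc.prems(1)])
    then show ?thesis by (auto simp: differentiable_def)
  qed
  moreover have "Ck_on k S (\<lambda>x. frechet_derivative g (at x) v)" for v
    by (rule Suc.IH[of "\<lambda>x. frechet_derivative f (at x) v"]) (use Suc.prems(2) D in simp_all)
  ultimately show ?case by simp
qed

lemma Ck_on_subset: "Ck_on k S f \<Longrightarrow> T \<subseteq> S \<Longrightarrow> Ck_on k T f"
  by (induction k arbitrary: f) (auto intro: continuous_on_subset)

lemma Ck_on_lower: "Ck_on (Suc k) S f \<Longrightarrow> Ck_on k S f"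
proof (induction k arbitrary: f)
  case 0
  then show ?case
    by (auto intro!: continuous_at_imp_continuous_on differentiable_imp_continuous_within)
next
  case (Suc k)
  then show ?case by (metis Ck_on.simps(2))
qed

lemma Ck_on_local:
  assumes "\<And>x. x \<in> S \<Longrightarrow> \<exists>T. open T \<and> x \<in> T \<and> Ck_on k T f"
  shows "Ck_on k S f"
  using assms
proof (induction k arbitrary: f)
  case 0
  then show ?case
    by (metis Ck_on.simps(1) continuous_at_imp_continuous_on continuous_on_eq_continuous_at)
next
  case (Suc k)
  have "f differentiable at x" if "x \<in> S" for x
    using Suc.prems[OF that] by auto
  moreover have "Ck_on k S (\<lambda>x. frechet_derivative f (at x) v)" for v
    by (rule Suc.IH) (metis Suc.prems Ck_on.simps(2))
  ultimately show ?case by simp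
qed

lemma Ck_on_const: "Ck_on k S (\<lambda>_. c)"
  by (induction k arbitrary: c) auto

text \<open>Allows any convenient formula for the derivative in place of \<open>frechet_derivative\<close>, and so carries
  the inductive steps of the differentiation rules below.\<close>

lemma Ck_on_Suc_I:
  assumes "open S" "\<And>x. x \<in> S \<Longrightarrow> (f has_derivative f' x) (at x)"
    and "\<And>v. Ck_on k S (\<lambda>x. f' x v)"
  shows "Ck_on (Suc k) S f"
proof -
  have "frechet_derivative f (at x) = f' x" if "x \<in> S" for x
    using assms(2)[OF that] frechet_derivative_at by metis
  then have "Ck_on k S (\<lambda>x. frechet_derivative f (at x) v)" for v
    by (intro Ck_on_cong_imp[OF \<open>open S\<close> _ assms(3)[of v]]) simp
  moreover have "f differentiable at x" if "x \<in> S" for x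
    using assms(2)[OF that] by (rule differentiableI)
  ultimately show ?thesis by simp
qed

lemma Ck_on_derivative:
  assumes "Ck_on (Suc k) S f" "x \<in> S"
  shows "(f has_derivative frechet_derivative f (at x)) (at x)"
  using assms by (simp add: frechet_derivative_works)

lemma Ck_on_add:
  assumes "open S" "Ck_on k S f" "Ck_on k S g"
  shows "Ck_on k S (\<lambda>x. f x + g x)"
  using assms(2,3)
proof (induction k arbitrary: f g)
  case 0
  then show ?case using continuous_on_add by simp
next
  case (Suc k)
  show ?case
  proof (rule Ck_on_Suc_I[OF \<open>open S\<close>])
    show "((\<lambda>x. f x + g x) has_derivative
        (\<lambda>v. frechet_derivative f (at x) v + frechet_derivative g (at x) v)) (at x)"
      if "x \<in> S" for x
      using has_derivative_add[OF Ck_on_derivative[OF Suc.prems(1) that]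
          Ck_on_derivative[OF Suc.prems(2) that]] .
    show "Ck_on k S (\<lambda>x. frechet_derivative f (at x) v + frechet_derivative g (at x) v)" for v
      by (rule Suc.IH) (use Suc.prems in simp_all)
  qed
qed

lemma Ck_on_sum:
  assumes "open S" "finite I" "\<And>i. i \<in> I \<Longrightarrow> Ck_on k S (f i)"
  shows "Ck_on k S (\<lambda>x. \<Sum>i\<in>I. f i x)"
  using assms(2,3)
proof (induction I rule: finite_induct)
  case empty
  then show ?case by (simp add: Ck_on_const)
next
  case (insert i I)
  have "Ck_on k S (\<lambda>x. f i x + (\<Sum>i\<in>I. f i x))"
    by (rule Ck_on_add[OF assms(1)]) (use insert in blast)+
  then show ?case using insert.hyps by simp
qed

lemma Ck_on_bilinear:
  assumes "open S" "bounded_bilinear B" "Ck_on k S f" "Ck_on k S g"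
  shows "Ck_on k S (\<lambda>x. B (f x) (g x))"
  using assms(3,4)
proof (induction k arbitrary: f g)
  case 0
  then show ?case using bounded_bilinear.continuous_on[OF assms(2)] by auto
next
  case (Suc k)
  show ?case
  proof (rule Ck_on_Suc_I[OF \<open>open S\<close>])
    show "((\<lambda>x. B (f x) (g x)) has_derivative
        (\<lambda>v. B (f x) (frechet_derivative g (at x) v) + B (frechet_derivative f (at x) v) (g x))) (at x)"
      if "x \<in> S" for x
      using bounded_bilinear.FDERIV[OF assms(2) Ck_on_derivative[OF Suc.prems(1) that]
          Ck_on_derivative[OF Suc.prems(2) that]] .
    show "Ck_on k S (\<lambda>x. B (f x) (frechet_derivative g (at x) v) +
        B (frechet_derivative f (at x) v) (g x))" for v
      using Suc.prems Ck_on_lower[OF Suc.prems(1)] Ck_on_lower[OF Suc.prems(2)]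
      by (intro Ck_on_add[OF \<open>open S\<close>] Suc.IH) simp_all
  qed
qed

lemma Ck_on_linear_comp:
  assumes "open S" "bounded_linear A" "Ck_on k S f"
  shows "Ck_on k S (\<lambda>x. A (f x))"
  using assms(3)
proof (induction k arbitrary: f)
  case 0
  then show ?case using bounded_linear.continuous_on[OF assms(2)] by auto
next
  case (Suc k)
  show ?case
  proof (rule Ck_on_Suc_I[OF \<open>open S\<close>])
    show "((\<lambda>x. A (f x)) has_derivative (\<lambda>v. A (frechet_derivative f (at x) v))) (at x)"
      if "x \<in> S" for x
      using bounded_linear.has_derivative[OF assms(2) Ck_on_derivative[OF Suc.prems that]] .
    show "Ck_on k S (\<lambda>x. A (frechet_derivative f (at x) v))" for v
      by (rule Suc.IH) (use Suc.prems in simp)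
  qed
qed

lemma Ck_on_compose:
  fixes f :: "'a::euclidean_space \<Rightarrow> 'b::euclidean_space" and g :: "'b \<Rightarrow> 'c::real_normed_vector"
  assumes "open S" "open T" "f ` S \<subseteq> T" "Ck_on k S f" "Ck_on k T g"
  shows "Ck_on k S (g \<circ> f)"
  using assms(4,5)
proof (induction k arbitrary: g)
  case 0
  then show ?case
    using continuous_on_compose[of S f g] continuous_on_subset[of T g "f ` S"] assms(3) by auto
next
  case (Suc k)
  let ?Df = "\<lambda>x. frechet_derivative f (at x)" and ?Dg = "\<lambda>y. frechet_derivative g (at y)"
  \<comment> \<open>Expanding \<open>Df(x) v\<close> in the standard basis turns \<open>D(g \<circ> f)(x) v\<close> into a sum of products of
    partial derivatives, to which the product rule and the induction hypothesis apply.\<close>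
  show ?case
  proof (rule Ck_on_Suc_I[OF \<open>open S\<close>])
    fix x assume x: "x \<in> S"
    have g: "(g has_derivative ?Dg (f x)) (at (f x))"
      using Ck_on_derivative[OF Suc.prems(2)] x assms(3) by auto
    have "(g \<circ> f has_derivative ?Dg (f x) \<circ> ?Df x) (at x)"
      by (rule diff_chain_at[OF Ck_on_derivative[OF Suc.prems(1) x] g])
    moreover have "?Dg (f x) w = (\<Sum>b\<in>Basis. (w \<bullet> b) *\<^sub>R ?Dg (f x) b)" for w
    proof -
      interpret linear "?Dg (f x)" using g by (rule has_derivative_linear)
      have "?Dg (f x) w = ?Dg (f x) (\<Sum>b\<in>Basis. (w \<bullet> b) *\<^sub>R b)"
        by (simp add: euclidean_representation)
      then show ?thesis by (simp add: sum scaleR)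
    qed
    then have "?Dg (f x) \<circ> ?Df x = (\<lambda>v. \<Sum>b\<in>Basis. (?Df x v \<bullet> b) *\<^sub>R ?Dg (f x) b)"
      unfolding o_def by blast
    ultimately show "(g \<circ> f has_derivative (\<lambda>v. \<Sum>b\<in>Basis. (?Df x v \<bullet> b) *\<^sub>R ?Dg (f x) b)) (at x)"
      by metis
  next
    fix v
    have "Ck_on k S (\<lambda>x. ?Dg (f x) b)" for b
      using Suc.IH[OF Ck_on_lower[OF Suc.prems(1)], of "\<lambda>y. ?Dg y b"] Suc.prems(2)
      by (simp add: o_def)
    moreover have "Ck_on k S (\<lambda>x. ?Df x v \<bullet> b)" for b
      by (rule Ck_on_linear_comp[OF \<open>open S\<close> bounded_linear_inner_left]) (use Suc.prems in simp)
    ultimately show "Ck_on k S (\<lambda>x. \<Sum>b\<in>Basis. (?Df x v \<bullet> b) *\<^sub>R ?Dg (f x) b)"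
      by (intro Ck_on_sum[OF \<open>open S\<close> finite_Basis]
          Ck_on_bilinear[OF \<open>open S\<close> bounded_bilinear_scaleR])
  qed
qed

lemma smooth_on_cong:
  assumes "open S" "\<And>x. x \<in> S \<Longrightarrow> f x = g x"
  shows "smooth_on S f \<longleftrightarrow> smooth_on S g"
  unfolding smooth_on_def using assms Ck_on_cong_imp[OF assms(1)] by metis

lemma smooth_on_subset: "smooth_on S f \<Longrightarrow> T \<subseteq> S \<Longrightarrow> smooth_on T f"
  unfolding smooth_on_def by (auto intro: Ck_on_subset)

lemma smooth_on_local:
  assumes "\<And>x. x \<in> S \<Longrightarrow> \<exists>T. open T \<and> x \<in> T \<and> smooth_on T f"
  shows "smooth_on S f"
  using assms unfolding smooth_on_def by (metis Ck_on_local)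

lemma smooth_on_compose:
  fixes f :: "'a::euclidean_space \<Rightarrow> 'b::euclidean_space"
  assumes "open S" "open T" "f ` S \<subseteq> T" "smooth_on S f" "smooth_on T g"
  shows "smooth_on S (g \<circ> f)"
  using assms unfolding smooth_on_def by (auto intro: Ck_on_compose)

lemma smooth_on_has_derivative:
  "smooth_on S f \<Longrightarrow> x \<in> S \<Longrightarrow> (f has_derivative frechet_derivative f (at x)) (at x)"
  unfolding smooth_on_def by (meson Ck_on_derivative)

lemma smooth_on_imp_continuous_on: "smooth_on S f \<Longrightarrow> continuous_on S f"
  unfolding smooth_on_def by (metis Ck_on.simps(1))

text \<open>A constant derivative is trivially smooth. This is enough for linear and affine maps, and also for
  the transition maps of the circle, which are translations near each point.\<close>

lemma smooth_on_constant_derivative: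
  assumes "open S" "\<And>x. x \<in> S \<Longrightarrow> (f has_derivative A) (at x)"
  shows "smooth_on S f"
  unfolding smooth_on_def
proof
  fix k
  have "Ck_on (Suc k) S f"
    by (rule Ck_on_Suc_I[OF assms]) (auto intro: Ck_on_const)
  then show "Ck_on k S f" by (rule Ck_on_lower)
qed

lemma smooth_on_linear: "open S \<Longrightarrow> bounded_linear f \<Longrightarrow> smooth_on S f"
  by (rule smooth_on_constant_derivative) (auto intro: bounded_linear_imp_has_derivative)

lemma smooth_on_Pair:
  fixes f :: "'a::euclidean_space \<Rightarrow> 'b::euclidean_space"
    and g :: "'a \<Rightarrow> 'c::euclidean_space"
  assumes "open S" "smooth_on S f" "smooth_on S g"
  shows "smooth_on S (\<lambda>x. (f x, g x))"
proof -
  have f: "bounded_linear (\<lambda>y::'b. (y, 0::'c))" and g: "bounded_linear (\<lambda>z::'c. (0::'b, z))"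
    by (auto intro!: bounded_linear_intros)
  have "Ck_on k S (\<lambda>x. (f x, 0) + (0, g x))" for k
    using assms(2,3) unfolding smooth_on_def
    by (intro Ck_on_add Ck_on_linear_comp[OF _ f] Ck_on_linear_comp[OF _ g] \<open>open S\<close>) auto
  then show ?thesis by (simp add: smooth_on_def)
qed


section \<open>Charts and smooth maps between manifolds\<close>

lemma is_chart_openin: "is_chart X c \<Longrightarrow> openin X (fst c)"
  and is_chart_open_image: "is_chart X c \<Longrightarrow> open (snd c ` fst c)"
  by (auto simp: is_chart_def)

lemma is_chart_inj_on: "is_chart X c \<Longrightarrow> inj_on (snd c) (fst c)"
  unfolding is_chart_def homeomorphic_eq_everything_map
  by (metis openin_subset inf.absorb2 topspace_subtopology)

lemma chart_inv_left [simp]: "is_chart X c \<Longrightarrow> p \<in> fst c \<Longrightarrow> chart_inv c (snd c p) = p"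
  by (simp add: inv_into_f_f is_chart_inj_on)

lemma is_chartI:
  assumes "openin X (fst c)" "open V" "homeomorphic_maps (subtopology X (fst c)) (top_of_set V) (snd c) g"
  shows "is_chart X c"
proof -
  have "homeomorphic_map (subtopology X (fst c)) (top_of_set V) (snd c)"
    using assms(3) homeomorphic_map_maps by blast
  moreover from this have "snd c ` fst c = V"
    using homeomorphic_imp_surjective_map openin_subset[OF assms(1)] by (fastforce simp: inf.absorb2)
  ultimately show ?thesis using assms by (simp add: is_chart_def)
qed

lemma chart_homeomorphic_maps:
  assumes "is_chart X c"
  shows "homeomorphic_maps (subtopology X (fst c)) (top_of_set (snd c ` fst c)) (snd c) (chart_inv c)"
proof -
  have ts: "topspace (subtopology X (fst c)) = fst c"
    using openin_subset[OF is_chart_openin[OF assms]] by auto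
  obtain g where g: "homeomorphic_maps (subtopology X (fst c)) (top_of_set (snd c ` fst c)) (snd c) g"
    using assms by (auto simp: is_chart_def homeomorphic_map_maps)
  have "g y = chart_inv c y" if "y \<in> snd c ` fst c" for y
    using that g ts assms by (auto simp: homeomorphic_maps_def)
  moreover have "continuous_map (top_of_set (snd c ` fst c)) (subtopology X (fst c)) (chart_inv c)"
    by (rule continuous_map_eq[of _ _ g]) (use g calculation in \<open>auto simp: homeomorphic_maps_def\<close>)
  ultimately show ?thesis using g assms ts by (auto simp: homeomorphic_maps_def)
qed

lemma continuous_map_chart: "is_chart X c \<Longrightarrow> continuous_map (subtopology X (fst c)) euclidean (snd c)"
  using chart_homeomorphic_maps[of X c]
  by (auto simp: homeomorphic_maps_def continuous_map_in_subtopology)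

lemma continuous_map_chart_inv:
  "is_chart X c \<Longrightarrow> continuous_map (top_of_set (snd c ` fst c)) X (chart_inv c)"
  using chart_homeomorphic_maps[of X c]
  by (auto simp: homeomorphic_maps_def continuous_map_in_subtopology)

lemma open_chart_image:
  assumes "is_chart X c" "openin X U" "U \<subseteq> fst c"
  shows "open (snd c ` U)"
proof -
  have "homeomorphic_map (subtopology X (fst c)) (top_of_set (snd c ` fst c)) (snd c)"
    using assms(1) by (simp add: is_chart_def)
  moreover have "openin (subtopology X (fst c)) U"
    using assms by (simp add: openin_open_subtopology is_chart_openin)
  ultimately have "openin (top_of_set (snd c ` fst c)) (snd c ` U)"
    using homeomorphic_imp_open_map open_map_def by blast
  then show ?thesis
    using openin_open_trans is_chart_open_image[OF assms(1)] by blast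
qed

text \<open>The topological part of the axioms of a smooth manifold, which is what the composition of smooth
  maps relies on: coordinate domains are open, and every point of the middle manifold has a chart.\<close>

definition charted :: "('m, 'e::euclidean_space) mfd \<Rightarrow> bool" where
  "charted M \<longleftrightarrow> (\<forall>c\<in>atlas M. is_chart (mtop M) c) \<and> (\<Union>c\<in>atlas M. fst c) = points M"

lemma smooth_manifold_charted: "smooth_manifold M \<Longrightarrow> charted M"
  by (simp add: smooth_manifold_def charted_def)

lemma charted_is_chart: "charted M \<Longrightarrow> c \<in> atlas M \<Longrightarrow> is_chart (mtop M) c"
  by (simp add: charted_def)

lemma charted_cover:
  assumes "charted M" "p \<in> points M"
  obtains c where "c \<in> atlas M" "p \<in> fst c" "is_chart (mtop M) c"
  using assms unfolding charted_def by blast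

lemma openin_chart_preimage:
  assumes "continuous_map X Y f" "is_chart X c" "is_chart Y d"
  shows "openin X {p \<in> fst c. f p \<in> fst d}"
proof -
  have "openin X (fst c \<inter> {p \<in> topspace X. f p \<in> fst d})"
    by (intro openin_Int openin_continuous_map_preimage[OF assms(1)] is_chart_openin assms)
  moreover have "fst c \<inter> {p \<in> topspace X. f p \<in> fst d} = {p \<in> fst c. f p \<in> fst d}"
    using openin_subset[OF is_chart_openin[OF assms(2)]] by auto
  ultimately show ?thesis by simp
qed

lemma smooth_mapD:
  "smooth_map M N f \<Longrightarrow> c \<in> atlas M \<Longrightarrow> d \<in> atlas N \<Longrightarrow>
    smooth_on (snd c ` {p \<in> fst c. f p \<in> fst d}) (snd d \<circ> f \<circ> chart_inv c)"
  and smooth_map_continuous: "smooth_map M N f \<Longrightarrow> continuous_map (mtop M) (mtop N) f"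
  and smooth_map_in: "smooth_map M N f \<Longrightarrow> p \<in> points M \<Longrightarrow> f p \<in> points N"
  by (auto simp: smooth_map_def continuous_map_def)

lemma smooth_map_cong:
  assumes "charted M" "charted N" "smooth_map M N f" "\<And>p. p \<in> points M \<Longrightarrow> f p = g p"
  shows "smooth_map M N g"
proof -
  have "continuous_map (mtop M) (mtop N) g"
    using continuous_map_eq[OF smooth_map_continuous[OF assms(3)] assms(4)] by blast
  moreover have "smooth_on (snd c ` {p \<in> fst c. g p \<in> fst d}) (snd d \<circ> g \<circ> chart_inv c)"
    if "c \<in> atlas M" "d \<in> atlas N" for c d
  proof -
    have c: "is_chart (mtop M) c" and d: "is_chart (mtop N) d"
      using assms that charted_is_chart by blast+
    have sub: "fst c \<subseteq> points M" using openin_subset[OF is_chart_openin[OF c]] .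
    have eq: "{p \<in> fst c. g p \<in> fst d} = {p \<in> fst c. f p \<in> fst d}"
      using assms(4) sub by auto
    have "open (snd c ` {p \<in> fst c. f p \<in> fst d})"
      by (intro open_chart_image[OF c] openin_chart_preimage[OF smooth_map_continuous[OF assms(3)]] c d) auto
    then show ?thesis
      using smooth_mapD[OF assms(3) that] unfolding eq
      by (subst smooth_on_cong[where g = "snd d \<circ> f \<circ> chart_inv c"])
        (use c sub assms(4) in \<open>auto simp: subset_iff\<close>)
  qed
  ultimately show ?thesis by (simp add: smooth_map_def)
qed

lemma smooth_map_compose:
  fixes f :: "'m \<Rightarrow> 'n" and g :: "'n \<Rightarrow> 'l"
    and M :: "('m, 'e::euclidean_space) mfd" and N :: "('n, 'f::euclidean_space) mfd"
    and L :: "('l, 'g::euclidean_space) mfd"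
  assumes "charted M" "charted N" "charted L" "smooth_map M N f" "smooth_map N L g"
  shows "smooth_map M L (g \<circ> f)"
proof -
  have cf: "continuous_map (mtop M) (mtop N) f" and cg: "continuous_map (mtop N) (mtop L) g"
    using assms smooth_map_continuous by blast+
  have "smooth_on (snd c ` {p \<in> fst c. (g \<circ> f) p \<in> fst e}) (snd e \<circ> (g \<circ> f) \<circ> chart_inv c)"
    if ce: "c \<in> atlas M" "e \<in> atlas L" for c e
  proof (rule smooth_on_local)
    fix x assume "x \<in> snd c ` {p \<in> fst c. (g \<circ> f) p \<in> fst e}"
    then obtain p where p: "x = snd c p" "p \<in> fst c" "g (f p) \<in> fst e" by auto
    have c: "is_chart (mtop M) c" and e: "is_chart (mtop L) e"
      using assms ce charted_is_chart by blast+
    have sub: "fst c \<subseteq> points M" using openin_subset[OF is_chart_openin[OF c]] .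
    \<comment> \<open>Near \<open>x\<close> the coordinate expression factors through any chart around \<open>f p\<close>.\<close>
    obtain d where d: "d \<in> atlas N" "f p \<in> fst d" "is_chart (mtop N) d"
      using charted_cover[OF assms(2)] smooth_map_in[OF assms(4)] p sub by blast
    define T where "T = {p \<in> fst c. f p \<in> fst d} \<inter> {p \<in> fst c. (g \<circ> f) p \<in> fst e}"
    define W where "W = snd d ` {q \<in> fst d. g q \<in> fst e}"
    have oT: "open (snd c ` T)"
      unfolding T_def
      by (intro open_chart_image[OF c] openin_Int openin_chart_preimage[of _ "mtop N"]
          openin_chart_preimage[of _ "mtop L"] continuous_map_compose[OF cf cg] cf c d e) auto
    have oW: "open W"
      unfolding W_def by (intro open_chart_image[OF d(3)] openin_chart_preimage[OF cg] d e) auto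
    have "smooth_on (snd c ` T) ((snd e \<circ> g \<circ> chart_inv d) \<circ> (snd d \<circ> f \<circ> chart_inv c))"
    proof (rule smooth_on_compose[OF oT oW])
      show "(snd d \<circ> f \<circ> chart_inv c) ` snd c ` T \<subseteq> W"
        using c by (auto simp: T_def W_def)
      show "smooth_on (snd c ` T) (snd d \<circ> f \<circ> chart_inv c)"
        by (rule smooth_on_subset[OF smooth_mapD[OF assms(4) ce(1) d(1)]]) (auto simp: T_def)
      show "smooth_on W (snd e \<circ> g \<circ> chart_inv d)"
        unfolding W_def by (rule smooth_mapD[OF assms(5) d(1) ce(2)])
    qed
    then have "smooth_on (snd c ` T) (snd e \<circ> (g \<circ> f) \<circ> chart_inv c)"
      by (subst smooth_on_cong[OF oT, where g = "(snd e \<circ> g \<circ> chart_inv d) \<circ> (snd d \<circ> f \<circ> chart_inv c)"])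
        (use c d in \<open>auto simp: T_def\<close>)
    then show "\<exists>T. open T \<and> x \<in> T \<and> smooth_on T (snd e \<circ> (g \<circ> f) \<circ> chart_inv c)"
      using oT p d by (intro exI[of _ "snd c ` T"]) (auto simp: T_def)
  qed
  then show ?thesis using continuous_map_compose[OF cf cg] by (simp add: smooth_map_def)
qed

lemma open_submfd_simps [simp]:
  "mtop (open_submfd M U) = subtopology (mtop M) U"
  "atlas (open_submfd M U) = (\<lambda>c. (fst c \<inter> U, snd c)) ` atlas M"
  by (simp_all add: open_submfd_def)

lemma open_submfd_open_submfd: "V \<subseteq> U \<Longrightarrow> open_submfd (open_submfd M U) V = open_submfd M V"
  by (simp add: open_submfd_def subtopology_subtopology image_image Int_assoc inf.absorb2)

lemma is_chart_restrict:
  assumes "is_chart X c" "openin X U"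
  shows "is_chart (subtopology X U) (fst c \<inter> U, snd c)"
proof -
  have o: "openin X (fst c \<inter> U)" using assms by (simp add: is_chart_openin openin_Int)
  have "homeomorphic_map (subtopology X (fst c \<inter> U)) (top_of_set (snd c ` (fst c \<inter> U))) (snd c)"
  proof -
    have h: "homeomorphic_map (subtopology X (fst c)) (top_of_set (snd c ` fst c)) (snd c)"
      using assms(1) by (simp add: is_chart_def)
    have "homeomorphic_map (subtopology (subtopology X (fst c)) (fst c \<inter> U))
        (subtopology (top_of_set (snd c ` fst c)) (snd c ` (fst c \<inter> U))) (snd c)"
      by (rule homeomorphic_map_subtopologies[OF h])
        (use openin_subset[OF o] openin_subset[OF is_chart_openin[OF assms(1)]] in auto)
    moreover have "snd c ` fst c \<inter> snd c ` (fst c \<inter> U) = snd c ` (fst c \<inter> U)" by auto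
    ultimately show ?thesis by (simp add: subtopology_subtopology Int_assoc[symmetric])
  qed
  moreover have "open (snd c ` (fst c \<inter> U))" using o assms by (intro open_chart_image) auto
  ultimately show ?thesis
    using o assms(2)
    by (simp add: is_chart_def subtopology_subtopology openin_open_subtopology inf.absorb2 Int_ac)
qed

lemma charted_open_submfd: "charted M \<Longrightarrow> openin (mtop M) U \<Longrightarrow> charted (open_submfd M U)"
  unfolding charted_def by (auto simp: is_chart_restrict)

lemma inv_into_Int:
  "inj_on f A \<Longrightarrow> y \<in> f ` (A \<inter> B) \<Longrightarrow> inv_into (A \<inter> B) f y = inv_into A f y"
  by (metis IntD1 image_iff inj_on_Int inv_into_f_f)

lemma smooth_map_open_submfd:
  assumes "charted M" "charted N" "openin (mtop M) U" "smooth_map M N f"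
  shows "smooth_map (open_submfd M U) N f"
proof -
  have "smooth_on (snd c ` {p \<in> fst c \<inter> U. f p \<in> fst d}) (snd d \<circ> f \<circ> inv_into (fst c \<inter> U) (snd c))"
    if "c \<in> atlas M" "d \<in> atlas N" for c d
  proof -
    have c: "is_chart (mtop M) c" and d: "is_chart (mtop N) d"
      using assms that charted_is_chart by blast+
    have eq: "{p \<in> fst c \<inter> U. f p \<in> fst d} = {p \<in> fst c. f p \<in> fst d} \<inter> U" by auto
    have o: "open (snd c ` {p \<in> fst c \<inter> U. f p \<in> fst d})"
      unfolding eq
      by (intro open_chart_image[OF c] openin_Int assms(3)
          openin_chart_preimage[OF smooth_map_continuous[OF assms(4)] c d]) auto
    have "smooth_on (snd c ` {p \<in> fst c \<inter> U. f p \<in> fst d}) (snd d \<circ> f \<circ> chart_inv c)"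
      by (rule smooth_on_subset[OF smooth_mapD[OF assms(4) that]]) auto
    then show ?thesis
      by (subst smooth_on_cong[OF o, where g = "snd d \<circ> f \<circ> chart_inv c"])
        (auto simp: inv_into_Int is_chart_inj_on[OF c])
  qed
  then show ?thesis
    using assms by (auto simp: smooth_map_def continuous_map_from_subtopology)
qed

lemma smooth_map_into_open_submfd_iff:
  fixes M :: "('m, 'e::euclidean_space) mfd" and N :: "('n, 'f::euclidean_space) mfd"
  assumes "charted M"
  shows "smooth_map M (open_submfd N U) f \<longleftrightarrow> smooth_map M N f \<and> f ` points M \<subseteq> U"
proof -
  have "snd c ` {p \<in> fst c. f p \<in> fst d \<inter> U} = snd c ` {p \<in> fst c. f p \<in> fst d}"
    if "f ` points M \<subseteq> U" "c \<in> atlas M" for c and d :: "('n, 'f) chart"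
  proof -
    have "fst c \<subseteq> points M"
      using openin_subset[OF is_chart_openin] that(2) assms charted_is_chart by blast
    then show ?thesis using that(1) by auto
  qed
  then have "(\<forall>c\<in>atlas M. \<forall>d\<in>atlas N.
        smooth_on (snd c ` {p \<in> fst c. f p \<in> fst d \<inter> U}) (snd d \<circ> f \<circ> chart_inv c)) \<longleftrightarrow>
      (\<forall>c\<in>atlas M. \<forall>d\<in>atlas N.
        smooth_on (snd c ` {p \<in> fst c. f p \<in> fst d}) (snd d \<circ> f \<circ> chart_inv c))"
    if "f ` points M \<subseteq> U"
    using that by (metis (no_types, lifting))
  then show ?thesis
    unfolding smooth_map_def open_submfd_simps ball_simps(9) fst_conv snd_conv
      continuous_map_in_subtopology image_subset_iff_funcset[symmetric] by blast
qed

lemma open_euclidean_simps [simp]: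
  "mtop (open_euclidean W) = top_of_set W"
  "atlas (open_euclidean W) = {(W, id)}"
  by (simp_all add: open_euclidean_def)

lemma charted_open_euclidean: "open W \<Longrightarrow> charted (open_euclidean W)"
  unfolding charted_def by (auto simp: is_chart_def subtopology_subtopology homeomorphic_map_id)

lemma smooth_map_open_euclideanI:
  assumes "open W" "f ` W \<subseteq> V" "smooth_on W f"
  shows "smooth_map (open_euclidean W) (open_euclidean V) f"
proof -
  have "{p \<in> W. f p \<in> V} = W" using assms(2) by auto
  moreover have "smooth_on W (f \<circ> inv_into W id)"
    by (subst smooth_on_cong[OF assms(1), where g = f]) (auto simp: assms(3) inv_into_f_f)
  ultimately show ?thesis
    using assms by (auto simp: smooth_map_def continuous_map_in_subtopology smooth_on_imp_continuous_on)
qed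

lemma smooth_map_from_open_euclideanD:
  assumes "open W" "charted N" "smooth_map (open_euclidean W) N f" "d \<in> atlas N"
  shows "open {x \<in> W. f x \<in> fst d}" "smooth_on {x \<in> W. f x \<in> fst d} (snd d \<circ> f)"
proof -
  have "is_chart (mtop (open_euclidean W)) (W, id)"
    using charted_is_chart[OF charted_open_euclidean[OF assms(1)]] by simp
  then have "openin (top_of_set W) {x \<in> W. f x \<in> fst d}"
    using openin_chart_preimage[OF smooth_map_continuous[OF assms(3)] _ charted_is_chart[OF assms(2,4)]]
    by fastforce
  then show o: "open {x \<in> W. f x \<in> fst d}"
    using assms(1) openin_open_trans by blast
  have "smooth_on {x \<in> W. f x \<in> fst d} (snd d \<circ> f \<circ> inv_into W id)"
    using smooth_mapD[OF assms(3) _ assms(4), of "(W, id)"] by simp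
  then show "smooth_on {x \<in> W. f x \<in> fst d} (snd d \<circ> f)"
    by (subst smooth_on_cong[OF o, where g = "snd d \<circ> f \<circ> inv_into W id"]) (auto simp: inv_into_f_f)
qed

lemma smooth_map_from_open_euclideanI:
  assumes "open W" "charted N" "continuous_map (top_of_set W) (mtop N) f"
    and "\<And>d. d \<in> atlas N \<Longrightarrow> smooth_on {x \<in> W. f x \<in> fst d} (snd d \<circ> f)"
  shows "smooth_map (open_euclidean W) N f"
proof -
  have "smooth_on {x \<in> W. f x \<in> fst d} (snd d \<circ> f \<circ> inv_into W id)" if "d \<in> atlas N" for d
  proof -
    have "openin (top_of_set W) {x \<in> topspace (top_of_set W). f x \<in> fst d}"
      using openin_continuous_map_preimage[OF assms(3)]
        is_chart_openin[OF charted_is_chart[OF assms(2) that]] by blast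
    then have o: "open {x \<in> W. f x \<in> fst d}"
      using assms(1) openin_open_trans by fastforce
    show ?thesis
      using assms(4)[OF that]
      by (subst smooth_on_cong[OF o, where g = "snd d \<circ> f"]) (auto simp: inv_into_f_f)
  qed
  then show ?thesis using assms(3) by (simp add: smooth_map_def)
qed

text \<open>In this form the codomain enters through the inclusion of the image only, so that it can be
  enlarged or shrunk at will.\<close>

lemma smooth_map_to_open_euclidean_iff:
  assumes "charted X"
  shows "smooth_map X (open_euclidean V) f \<longleftrightarrow> continuous_map (mtop X) euclidean f \<and>
    f ` points X \<subseteq> V \<and> (\<forall>e\<in>atlas X. smooth_on (snd e ` fst e) (f \<circ> chart_inv e))"
proof -
  have "{p \<in> fst e. f p \<in> V} = fst e" if "f ` points X \<subseteq> V" "e \<in> atlas X" for e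
    using openin_subset[OF is_chart_openin[OF charted_is_chart[OF assms that(2)]]] that(1) by auto
  then have "(\<forall>e\<in>atlas X. smooth_on (snd e ` {p \<in> fst e. f p \<in> V}) (f \<circ> chart_inv e)) \<longleftrightarrow>
      (\<forall>e\<in>atlas X. smooth_on (snd e ` fst e) (f \<circ> chart_inv e))" if "f ` points X \<subseteq> V"
    using that by simp
  then show ?thesis
    unfolding smooth_map_def by (auto simp: continuous_map_in_subtopology)
qed

lemma smooth_map_open_euclidean_Pair:
  fixes f :: "'m \<Rightarrow> 'a::euclidean_space" and h :: "'m \<Rightarrow> 'b::euclidean_space"
  assumes "charted X" "smooth_map X (open_euclidean V) f" "smooth_map X (open_euclidean W) h"
  shows "smooth_map X (open_euclidean (V \<times> W)) (\<lambda>p. (f p, h p))"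
proof -
  note f = assms(2)[unfolded smooth_map_to_open_euclidean_iff[OF assms(1)]]
    and h = assms(3)[unfolded smooth_map_to_open_euclidean_iff[OF assms(1)]]
  have "smooth_on (snd e ` fst e) (\<lambda>x. ((f \<circ> chart_inv e) x, (h \<circ> chart_inv e) x))" if "e \<in> atlas X" for e
  proof (rule smooth_on_Pair)
    show "open (snd e ` fst e)" using is_chart_open_image[OF charted_is_chart[OF assms(1) that]] .
  qed (use f h that in blast)+
  moreover have "continuous_map (mtop X) (prod_topology euclidean euclidean) (\<lambda>p. (f p, h p))"
    using f h by (intro continuous_map_pairedI) blast+
  ultimately show ?thesis
    using f h unfolding smooth_map_to_open_euclidean_iff[OF assms(1)] by (auto simp: o_def)
qed

lemma prod_mfd_simps [simp]:
  "mtop (prod_mfd M N) = prod_topology (mtop M) (mtop N)"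
  "atlas (prod_mfd M N) =
    {(fst c \<times> fst d, map_prod (snd c) (snd d)) | c d. c \<in> atlas M \<and> d \<in> atlas N}"
  by (simp_all add: prod_mfd_def)


section \<open>Products\<close>

lemma is_chart_prod:
  assumes "is_chart X c" "is_chart Y d"
  shows "is_chart (prod_topology X Y) (fst c \<times> fst d, map_prod (snd c) (snd d))"
proof (rule is_chartI)
  show "openin (prod_topology X Y) (fst (fst c \<times> fst d, map_prod (snd c) (snd d)))"
    using assms by (simp add: openin_prod_Times_iff is_chart_openin)
  show "open (snd c ` fst c \<times> snd d ` fst d)"
    using assms by (simp add: open_Times is_chart_open_image)
  have "homeomorphic_maps (prod_topology (subtopology X (fst c)) (subtopology Y (fst d)))
      (prod_topology (top_of_set (snd c ` fst c)) (top_of_set (snd d ` fst d)))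
      (\<lambda>(x, y). (snd c x, snd d y)) (\<lambda>(x, y). (chart_inv c x, chart_inv d y))"
    using assms by (simp add: homeomorphic_maps_prod chart_homeomorphic_maps del: prod_topology_subtopology_eu)
  then show "homeomorphic_maps (subtopology (prod_topology X Y)
        (fst (fst c \<times> fst d, map_prod (snd c) (snd d)))) (top_of_set (snd c ` fst c \<times> snd d ` fst d))
      (snd (fst c \<times> fst d, map_prod (snd c) (snd d))) (\<lambda>(x, y). (chart_inv c x, chart_inv d y))"
    by (simp add: subtopology_Times map_prod_def)
qed

lemma charted_prod_mfd: "charted M \<Longrightarrow> charted N \<Longrightarrow> charted (prod_mfd M N)"
  unfolding charted_def
proof (intro conjI ballI)
  assume M: "(\<forall>c\<in>atlas M. is_chart (mtop M) c) \<and> (\<Union>c\<in>atlas M. fst c) = points M"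
    and N: "(\<forall>c\<in>atlas N. is_chart (mtop N) c) \<and> (\<Union>c\<in>atlas N. fst c) = points N"
  show "is_chart (mtop (prod_mfd M N)) c" if "c \<in> atlas (prod_mfd M N)" for c
    using that M N is_chart_prod by fastforce
  have "(\<Union>c\<in>atlas (prod_mfd M N). fst c) = (\<Union>c\<in>atlas M. fst c) \<times> (\<Union>c\<in>atlas N. fst c)"
    (is "?L = ?R")
  proof
    show "?R \<subseteq> ?L"
    proof clarify
      fix p q c d assume cd: "c \<in> atlas M" "p \<in> fst c" "d \<in> atlas N" "q \<in> fst d"
      then have "(fst c \<times> fst d, map_prod (snd c) (snd d)) \<in> atlas (prod_mfd M N)"
        unfolding prod_mfd_simps by blast
      then show "(p, q) \<in> ?L" by (rule UN_I) (simp add: cd)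
    qed
  qed auto
  then show "(\<Union>c\<in>atlas (prod_mfd M N). fst c) = points (prod_mfd M N)"
    using M N by simp
qed

lemma smooth_map_Pair:
  assumes "charted X" "charted M" "charted N" "smooth_map X M f" "smooth_map X N h"
  shows "smooth_map X (prod_mfd M N) (\<lambda>p. (f p, h p))"
proof -
  have "smooth_on (snd e ` {p \<in> fst e. (f p, h p) \<in> fst c \<times> fst d})
      (map_prod (snd c) (snd d) \<circ> (\<lambda>p. (f p, h p)) \<circ> chart_inv e)"
    if "e \<in> atlas X" "c \<in> atlas M" "d \<in> atlas N" for e c d
  proof -
    let ?T = "snd e ` {p \<in> fst e. (f p, h p) \<in> fst c \<times> fst d}"
    have e: "is_chart (mtop X) e" and c: "is_chart (mtop M) c" and d: "is_chart (mtop N) d"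
      using that assms charted_is_chart by blast+
    have eq: "{p \<in> fst e. (f p, h p) \<in> fst c \<times> fst d} = {p \<in> fst e. f p \<in> fst c} \<inter> {p \<in> fst e. h p \<in> fst d}"
      by auto
    have o: "open ?T"
      unfolding eq by (intro open_chart_image[OF e] openin_Int openin_chart_preimage[OF _ e c]
          openin_chart_preimage[OF _ e d] smooth_map_continuous assms) auto
    have "smooth_on ?T (\<lambda>x. ((snd c \<circ> f \<circ> chart_inv e) x, (snd d \<circ> h \<circ> chart_inv e) x))"
      by (rule smooth_on_Pair[OF o smooth_on_subset[OF smooth_mapD[OF assms(4) that(1,2)]]
            smooth_on_subset[OF smooth_mapD[OF assms(5) that(1,3)]]]) auto
    then show ?thesis by (simp add: o_def map_prod_def)
  qed
  then show ?thesis
    using continuous_map_pairedI[OF smooth_map_continuous smooth_map_continuous, OF assms(4,5)]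
    by (auto simp: smooth_map_def)
qed

text \<open>The coordinate expressions of the projection are transition maps of the second factor, preceded by
  a linear projection; this is why the charts of \<open>N\<close> have to be compatible.\<close>

lemma smooth_map_snd:
  fixes M :: "('m, 'e::euclidean_space) mfd" and N :: "('n, 'f::euclidean_space) mfd"
  assumes "charted M" "charted N" "\<And>d e. d \<in> atlas N \<Longrightarrow> e \<in> atlas N \<Longrightarrow> compatible d e"
  shows "smooth_map (prod_mfd M N) N snd"
proof -
  have "smooth_on (map_prod (snd c) (snd d) ` {p \<in> fst c \<times> fst d. snd p \<in> fst e})
      (snd e \<circ> snd \<circ> inv_into (fst c \<times> fst d) (map_prod (snd c) (snd d)))"
    if "c \<in> atlas M" "d \<in> atlas N" "e \<in> atlas N" for c d e
  proof -
    have c: "is_chart (mtop M) c" and d: "is_chart (mtop N) d" and e: "is_chart (mtop N) e"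
      using that assms charted_is_chart by blast+
    have eq: "map_prod (snd c) (snd d) ` {p \<in> fst c \<times> fst d. snd p \<in> fst e} =
        snd c ` fst c \<times> snd d ` (fst d \<inter> fst e)" (is "?T = _")
      by (auto simp: image_iff)
    have o2: "open (snd d ` (fst d \<inter> fst e))"
      by (intro open_chart_image[OF d] openin_Int is_chart_openin d e) auto
    have o: "open ?T"
      unfolding eq using o2 is_chart_open_image[OF c] by (rule open_Times[rotated])
    have "smooth_on ?T (transition d e \<circ> snd)"
      by (rule smooth_on_compose[OF o o2 _ smooth_on_linear[OF o bounded_linear_snd]])
        (use assms(3)[OF that(2,3)] in \<open>auto simp: eq compatible_def\<close>)
    moreover have "inv_into (fst c \<times> fst d) (map_prod (snd c) (snd d)) (snd c p, snd d q) = (p, q)"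
      if "p \<in> fst c" "q \<in> fst d" for p q
      using chart_inv_left[OF is_chart_prod[OF c d], of "(p, q)"] that by simp
    ultimately show ?thesis
      by (subst smooth_on_cong[OF o, where g = "transition d e \<circ> snd"]) (use d in \<open>auto simp: transition_def\<close>)
  qed
  then show ?thesis by (auto simp: smooth_map_def continuous_map_snd)
qed


section \<open>The circle\<close>

lemma not_nonpos_Reals_unit:
  fixes z :: complex
  shows "norm z = 1 \<Longrightarrow> z \<noteq> -1 \<Longrightarrow> z \<notin> \<real>\<^sub>\<le>\<^sub>0"
  by (auto simp: complex_nonpos_Reals_iff cmod_eq_Re complex_eq_iff)

definition circle_chart :: "complex \<Rightarrow> (complex, real) chart" where
  "circle_chart w = (circle - {- w}, \<lambda>z. Arg (z / w))"

lemma circle_mfd_simps [simp]: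
  "mtop circle_mfd = top_of_set circle" "atlas circle_mfd = circle_chart ` circle"
  by (auto simp: circle_mfd_def circle_chart_def)

lemma circle_chart_homeomorphic_maps:
  assumes "w \<in> circle"
  shows "homeomorphic_maps (top_of_set (circle - {- w})) (top_of_set {-pi<..<pi})
    (\<lambda>z. Arg (z / w)) (\<lambda>t. w * cis t)"
proof -
  have w: "w \<noteq> 0" "norm w = 1" using assms by auto
  have off: "z / w \<notin> \<real>\<^sub>\<le>\<^sub>0" "norm (z / w) = 1" if "z \<in> circle - {- w}" for z
  proof -
    show 1: "norm (z / w) = 1" using that w by (simp add: norm_divide)
    have "z / w \<noteq> -1" using that w by (auto simp: divide_eq_eq)
    then show "z / w \<notin> \<real>\<^sub>\<le>\<^sub>0" using 1 not_nonpos_Reals_unit by blast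
  qed
  have Arg: "Arg (z / w) \<in> {-pi<..<pi}" if "z \<in> circle - {- w}" for z
  proof -
    have "Arg (z / w) \<noteq> pi"
      using off[OF that] Arg_eq_pi[of "z / w"]
      by (auto simp: complex_nonpos_Reals_iff)
    then show ?thesis using mpi_less_Arg[of "z / w"] Arg_le_pi[of "z / w"] by auto
  qed
  have inv: "w * cis (Arg (z / w)) = z" if "z \<in> circle - {- w}" for z
  proof -
    have "z \<noteq> 0" using that by auto
    then show ?thesis using cis_Arg[of "z / w"] off(2)[OF that] w by (auto simp: sgn_eq)
  qed
  have cis: "w * cis t \<in> circle - {- w}" if "t \<in> {-pi<..<pi}" for t
  proof -
    have "cis t \<noteq> -1"
    proof
      assume "cis t = -1"
      then have "Arg (cis t) = pi" using Arg_of_real[of "-1"] by simp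
      then show False using Arg_cis[of t] that by auto
    qed
    then have "w * cis t \<noteq> - w" using w by (metis mult_cancel_left mult_minus1_right)
    then show ?thesis using w by (simp add: norm_mult)
  qed
  show ?thesis
    unfolding homeomorphic_maps_def
  proof (intro conjI ballI)
    show "continuous_map (top_of_set (circle - {- w})) (top_of_set {-pi<..<pi}) (\<lambda>z. Arg (z / w))"
      using Arg off(1) by (auto simp: continuous_map_in_subtopology intro!: continuous_intros w)
    show "continuous_map (top_of_set {-pi<..<pi}) (top_of_set (circle - {- w})) (\<lambda>t. w * cis t)"
      using cis by (auto simp: continuous_map_in_subtopology intro!: continuous_intros)
  qed (use inv w Arg_cis in auto)
qed

text \<open>Angles measured from different base points differ by a locally constant amount.\<close>

lemma Arg_mult_cis_has_derivative:
  assumes "u * cis t \<notin> \<real>\<^sub>\<le>\<^sub>0"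
  shows "((\<lambda>t. Arg (u * cis t)) has_derivative (\<lambda>h. h)) (at t)"
proof -
  have u: "u \<noteq> 0" using assms by auto
  have "((\<lambda>z. Ln (u * exp (\<i> * z))) has_field_derivative \<i>) (at (complex_of_real t))"
    using assms u by (auto intro!: derivative_eq_intros simp: cis_conv_exp field_simps)
  then have "((\<lambda>t. Ln (u * cis t)) has_vector_derivative \<i>) (at t)"
    unfolding cis_conv_exp by (rule has_vector_derivative_real_field)
  from bounded_linear.has_vector_derivative[OF bounded_linear_Im this]
  have "((\<lambda>t. Im (Ln (u * cis t))) has_derivative (\<lambda>h. h)) (at t)"
    by (simp add: has_vector_derivative_def)
  then show ?thesis using u by (simp add: Arg_eq_Im_Ln)
qed

lemma is_chart_circle_chart:
  assumes "w \<in> circle"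
  shows "is_chart (mtop circle_mfd) (circle_chart w)"
proof (rule is_chartI)
  have "openin (top_of_set circle) (circle \<inter> - {- w})"
    by (rule openin_open_Int) auto
  moreover have "circle \<inter> - {- w} = circle - {- w}" by auto
  ultimately show "openin (mtop circle_mfd) (fst (circle_chart w))"
    by (simp add: circle_chart_def)
  have "circle \<inter> (circle - {- w}) = circle - {- w}" by auto
  then show "homeomorphic_maps (subtopology (mtop circle_mfd) (fst (circle_chart w)))
      (top_of_set {-pi<..<pi}) (snd (circle_chart w)) (\<lambda>t. w * cis t)"
    using circle_chart_homeomorphic_maps[OF assms] by (simp add: circle_chart_def subtopology_subtopology)
qed auto

lemma circle_chart_simps:
  assumes "w \<in> circle"
  shows "fst (circle_chart w) = circle - {- w}" "snd (circle_chart w) z = Arg (z / w)"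
    "snd (circle_chart w) ` (circle - {- w}) = {-pi<..<pi}"
    "t \<in> {-pi<..<pi} \<Longrightarrow> inv_into (circle - {- w}) (snd (circle_chart w)) t = w * cis t"
proof -
  note h = circle_chart_homeomorphic_maps[OF assms]
  show 1: "fst (circle_chart w) = circle - {- w}" "snd (circle_chart w) z = Arg (z / w)" for z
    by (simp_all add: circle_chart_def)
  then have eq: "snd (circle_chart w) = (\<lambda>z. Arg (z / w))" by auto
  then show "snd (circle_chart w) ` (circle - {- w}) = {-pi<..<pi}"
    using homeomorphic_imp_surjective_map[of "top_of_set (circle - {- w})" "top_of_set {-pi<..<pi}"]
      homeomorphic_maps_imp_map[OF h] by simp
  show "inv_into (circle - {- w}) (snd (circle_chart w)) t = w * cis t" if "t \<in> {-pi<..<pi}"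
  proof -
    have "w * cis t \<in> circle - {- w}" "Arg (w * cis t / w) = t"
      using h that by (auto simp: homeomorphic_maps_def continuous_map_def Pi_iff)
    then show ?thesis
      using chart_inv_left[OF is_chart_circle_chart[OF assms], of "w * cis t"] 1 by simp
  qed
qed

lemma compatible_circle_chart:
  assumes w: "w \<in> circle" and v: "v \<in> circle"
  shows "compatible (circle_chart w) (circle_chart v)"
proof -
  have "smooth_on (snd (circle_chart w) ` (fst (circle_chart w) \<inter> fst (circle_chart v)))
      (transition (circle_chart w) (circle_chart v))"
    if w: "w \<in> circle" and v: "v \<in> circle" for w v
  proof -
    let ?S = "snd (circle_chart w) ` (fst (circle_chart w) \<inter> fst (circle_chart v))"
    have o: "open ?S"
      by (intro open_chart_image[OF is_chart_circle_chart[OF w]] openin_Int is_chart_openin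
          is_chart_circle_chart w v) auto
    have S: "t \<in> {-pi<..<pi}" "w * cis t \<noteq> - v" if "t \<in> ?S" for t
    proof -
      obtain z where "z \<in> fst (circle_chart w) \<inter> fst (circle_chart v)" "t = snd (circle_chart w) z"
        using \<open>t \<in> ?S\<close> by blast
      then have z: "z \<in> circle" "z \<noteq> - w" "z \<noteq> - v" "t = snd (circle_chart w) z"
        using circle_chart_simps(1) w v by blast+
      then show t: "t \<in> {-pi<..<pi}" using circle_chart_simps(3)[OF w] by blast
      show "w * cis t \<noteq> - v"
        using circle_chart_simps(4)[OF w t] chart_inv_left[OF is_chart_circle_chart[OF w], of z] z w
        by (simp add: circle_chart_simps)
    qed
    have "smooth_on ?S (\<lambda>t. Arg ((w / v) * cis t))"
    proof (rule smooth_on_constant_derivative[OF o Arg_mult_cis_has_derivative])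
      fix t assume "t \<in> ?S"
      then have "w * cis t / v \<noteq> -1" using S(2)[of t] v by (auto simp: divide_eq_eq)
      then show "w / v * cis t \<notin> \<real>\<^sub>\<le>\<^sub>0"
        using w v by (intro not_nonpos_Reals_unit) (auto simp: norm_mult norm_divide)
    qed
    then show ?thesis
      by (subst smooth_on_cong[OF o, where g = "\<lambda>t. Arg ((w / v) * cis t)"])
        (use S(1) w v in \<open>auto simp: transition_def circle_chart_simps\<close>)
  qed
  from this[OF w v] this[OF v w] show ?thesis
    unfolding compatible_def by (simp only: Int_commute)
qed

lemma circle_chart_maximal:
  "w \<in> circle \<Longrightarrow> circle_chart w \<in> maximal_atlas circle_mfd"
  by (auto simp: maximal_atlas_def is_chart_circle_chart compatible_circle_chart
      simp del: circle_mfd_simps(1))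

lemma charted_circle_mfd: "charted circle_mfd"
proof -
  have "z \<in> fst (circle_chart z)" if "z \<in> circle" for z
    using that by (auto simp: circle_chart_simps)
  moreover have "fst (circle_chart w) \<subseteq> circle" if "w \<in> circle" for w
    using that by (auto simp: circle_chart_simps)
  ultimately have "(\<Union>w\<in>circle. fst (circle_chart w)) = circle" by blast
  then have "(\<Union>c\<in>atlas circle_mfd. fst c) = points circle_mfd" by simp
  then show ?thesis unfolding charted_def using is_chart_circle_chart by auto
qed


section \<open>Local parametrizations\<close>

lemma maximal_atlasD:
  "c \<in> maximal_atlas M \<Longrightarrow> is_chart (mtop M) c"
  "c \<in> maximal_atlas M \<Longrightarrow> d \<in> atlas M \<Longrightarrow> compatible c d"
  by (auto simp: maximal_atlas_def)

lemma atlas_maximal: "smooth_manifold M \<Longrightarrow> c \<in> atlas M \<Longrightarrow> c \<in> maximal_atlas M"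
  by (auto simp: maximal_atlas_def smooth_manifold_def)

lemma maximal_chart_smooth_map:
  assumes "charted M" "c \<in> maximal_atlas M"
  shows "smooth_map (open_submfd M (fst c)) (open_euclidean (snd c ` fst c)) (snd c)"
proof -
  have c: "is_chart (mtop M) c" using maximal_atlasD assms(2) by blast
  have "smooth_on (snd d ` (fst d \<inter> fst c)) (snd c \<circ> inv_into (fst d \<inter> fst c) (snd d))"
    if "d \<in> atlas M" for d
  proof -
    have d: "is_chart (mtop M) d" using charted_is_chart[OF assms(1) that] .
    have "open (snd d ` (fst d \<inter> fst c))"
      by (intro open_chart_image[OF d] openin_Int is_chart_openin c d) auto
    moreover have "smooth_on (snd d ` (fst d \<inter> fst c)) (transition d c)"
      using maximal_atlasD(2)[OF assms(2) that] by (simp add: compatible_def Int_commute)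
    ultimately show ?thesis
      by (subst smooth_on_cong[where g = "transition d c"])
        (auto simp: transition_def inv_into_Int is_chart_inj_on[OF d])
  qed
  then show ?thesis
    using c continuous_map_chart[OF c] charted_open_submfd[OF assms(1) is_chart_openin[OF c]]
    by (subst smooth_map_to_open_euclidean_iff) auto
qed

lemma maximal_chart_inv_smooth_map:
  assumes "charted M" "c \<in> maximal_atlas M"
  shows "smooth_map (open_euclidean (snd c ` fst c)) M (chart_inv c)"
proof -
  have c: "is_chart (mtop M) c" using maximal_atlasD assms(2) by blast
  have eq: "{x \<in> snd c ` fst c. chart_inv c x \<in> fst d} = snd c ` (fst c \<inter> fst d)" for d
    using c by auto
  show ?thesis
  proof (rule smooth_map_from_open_euclideanI[OF is_chart_open_image[OF c] assms(1)
        continuous_map_chart_inv[OF c]])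
    show "smooth_on {x \<in> snd c ` fst c. chart_inv c x \<in> fst d} (snd d \<circ> chart_inv c)"
      if "d \<in> atlas M" for d
      using maximal_atlasD(2)[OF assms(2) that] unfolding eq by (simp add: compatible_def transition_def)
  qed
qed

text \<open>A diffeomorphism \<open>F\<close> from an open set \<open>V\<close> of a Euclidean space onto an open subset \<open>D\<close> of \<open>M\<close>,
  together with its inverse \<open>\<psi>\<close>. The Euclidean space need not be the model space of \<open>M\<close>: a
  circle bundle is parametrized by the product of the model space of its base with \<open>\<real>\<close>, which
  as a type need not be the model space of the total space.\<close>

definition local_param ::
    "('m, 'e::euclidean_space) mfd \<Rightarrow> 'v::euclidean_space set \<Rightarrow> ('v \<Rightarrow> 'm) \<Rightarrow> 'm set \<Rightarrow> ('m \<Rightarrow> 'v) \<Rightarrow> bool" where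
  "local_param M V F D \<psi> \<longleftrightarrow> openin (mtop M) D \<and> open V \<and>
     smooth_map (open_submfd M D) (open_euclidean V) \<psi> \<and> smooth_map (open_euclidean V) M F \<and>
     F ` V \<subseteq> D \<and> (\<forall>p\<in>D. F (\<psi> p) = p) \<and> (\<forall>y\<in>V. \<psi> (F y) = y)"

lemma local_param_in: "local_param M V F D \<psi> \<Longrightarrow> p \<in> D \<Longrightarrow> \<psi> p \<in> V"
proof -
  assume lp: "local_param M V F D \<psi>" and p: "p \<in> D"
  have "p \<in> points (open_submfd M D)"
    using lp p openin_subset[of "mtop M" D] unfolding local_param_def by auto
  then show ?thesis
    using smooth_map_in[of "open_submfd M D" "open_euclidean V" \<psi> p] lp
    unfolding local_param_def by simp
qed

lemma local_param_image: "local_param M V F D \<psi> \<Longrightarrow> \<psi> ` D = V"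
proof
  assume lp: "local_param M V F D \<psi>"
  show "\<psi> ` D \<subseteq> V" using local_param_in[OF lp] by (rule image_subsetI)
  show "V \<subseteq> \<psi> ` D"
  proof
    fix y assume "y \<in> V"
    then have "\<psi> (F y) = y" "F y \<in> D" using lp unfolding local_param_def by blast+
    then show "y \<in> \<psi> ` D" by (metis imageI)
  qed
qed

lemma local_param_coordinate:
  assumes "charted M" "local_param M V F D \<psi>" "d \<in> atlas M"
  shows "open (snd d ` (fst d \<inter> D))" "smooth_on (snd d ` (fst d \<inter> D)) (\<psi> \<circ> chart_inv d)"
proof -
  have D: "openin (mtop M) D" and sm: "smooth_map (open_submfd M D) (open_euclidean V) \<psi>"
    using assms(2) by (auto simp: local_param_def)
  have d: "is_chart (mtop M) d" using charted_is_chart assms by blast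
  show o: "open (snd d ` (fst d \<inter> D))"
    by (intro open_chart_image[OF d] openin_Int is_chart_openin d D) auto
  have "smooth_on (snd d ` (fst d \<inter> D)) (\<psi> \<circ> inv_into (fst d \<inter> D) (snd d))"
    using sm assms(3) unfolding smooth_map_to_open_euclidean_iff[OF charted_open_submfd[OF assms(1) D]]
    by force
  then show "smooth_on (snd d ` (fst d \<inter> D)) (\<psi> \<circ> chart_inv d)"
    by (subst smooth_on_cong[OF o, where g = "\<psi> \<circ> inv_into (fst d \<inter> D) (snd d)"])
      (auto simp: inv_into_Int is_chart_inj_on[OF d])
qed

lemma local_param_maximal_atlas:
  fixes M :: "('m, 'e::euclidean_space) mfd" and V :: "'e set"
  assumes "charted M" "local_param M V F D \<psi>"
  shows "(D, \<psi>) \<in> maximal_atlas M"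
proof -
  have D: "openin (mtop M) D" and V: "open V"
    and \<psi>: "smooth_map (open_submfd M D) (open_euclidean V) \<psi>"
    and F: "smooth_map (open_euclidean V) M F"
    and inv: "F ` V \<subseteq> D" "\<And>p. p \<in> D \<Longrightarrow> F (\<psi> p) = p" "\<And>y. y \<in> V \<Longrightarrow> \<psi> (F y) = y"
    using assms(2) by (auto simp: local_param_def)
  note im = local_param_image[OF assms(2)]
  have "is_chart (mtop M) (D, \<psi>)"
  proof (rule is_chartI)
    show "homeomorphic_maps (subtopology (mtop M) (fst (D, \<psi>))) (top_of_set V) (snd (D, \<psi>)) F"
      using smooth_map_continuous[OF \<psi>] smooth_map_continuous[OF F] inv
      by (auto simp: homeomorphic_maps_def continuous_map_in_subtopology)
  qed (use D V in auto)
  moreover have "compatible (D, \<psi>) d" if d: "d \<in> atlas M" for d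
  proof -
    note o = smooth_map_from_open_euclideanD[OF V assms(1) F d]
    have inj: "inj_on \<psi> D" using inv(2) by (metis inj_onI)
    have eq: "\<psi> ` (D \<inter> fst d) = {x \<in> V. F x \<in> fst d}"
    proof
      show "{x \<in> V. F x \<in> fst d} \<subseteq> \<psi> ` (D \<inter> fst d)"
        using inv by (auto intro!: image_eqI[of _ \<psi> "F _"])
    qed (use im inv(2) in auto)
    have "smooth_on (\<psi> ` (D \<inter> fst d)) (snd d \<circ> inv_into D \<psi>)"
      unfolding eq
    proof (subst smooth_on_cong[OF o(1), where g = "snd d \<circ> F"])
      show "(snd d \<circ> inv_into D \<psi>) x = (snd d \<circ> F) x" if "x \<in> {x \<in> V. F x \<in> fst d}" for x
        using inv_into_f_f[OF inj, of "F x"] inv that by auto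
    qed (rule o(2))
    then show ?thesis
      using local_param_coordinate(2)[OF assms d] by (simp add: compatible_def transition_def Int_commute)
  qed
  ultimately show ?thesis by (simp add: maximal_atlas_def)
qed

text \<open>Smooth invariance of dimension: the derivatives of a parametrization and of its inverse, both
  read in a chart of \<open>M\<close>, are mutually inverse. The isomorphism is used to carry parametrizations
  over to the model space of \<open>M\<close>, where they become charts.\<close>

lemma local_param_linear_iso:
  fixes M :: "('m, 'e::euclidean_space) mfd" and V :: "'v::euclidean_space set"
  assumes "charted M" "local_param M V F D \<psi>" "V \<noteq> {}"
  obtains L :: "'v \<Rightarrow> 'e" and K where "bounded_linear L" "bounded_linear K" "\<And>x. K (L x) = x" "\<And>y. L (K y) = y"
proof -
  obtain y where y: "y \<in> V" using assms(3) by blast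
  have V: "open V" and D: "openin (mtop M) D" and F: "smooth_map (open_euclidean V) M F"
    and inv: "F ` V \<subseteq> D" "\<And>p. p \<in> D \<Longrightarrow> F (\<psi> p) = p" "\<And>y. y \<in> V \<Longrightarrow> \<psi> (F y) = y"
    using assms(2) by (auto simp: local_param_def)
  have "F y \<in> points M" using y inv(1) openin_subset[OF D] by blast
  then obtain d where d: "d \<in> atlas M" "F y \<in> fst d" "is_chart (mtop M) d"
    using charted_cover[OF assms(1)] by blast
  note o1 = smooth_map_from_open_euclideanD[OF V assms(1) F d(1)]
    and o2 = local_param_coordinate[OF assms(1,2) d(1)]
  let ?f = "snd d \<circ> F" and ?g = "\<psi> \<circ> chart_inv d"
  define L where "L = frechet_derivative ?f (at y)"
  define K where "K = frechet_derivative ?g (at (?f y))"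
  have fy: "?f y \<in> snd d ` (fst d \<inter> D)" using y d inv by auto
  have gf: "(?g \<circ> ?f) x = x" if "x \<in> {x \<in> V. F x \<in> fst d}" for x using that inv d by auto
  have fg: "(?f \<circ> ?g) z = z" if "z \<in> snd d ` (fst d \<inter> D)" for z using that inv d by auto
  have L: "(?f has_derivative L) (at y)"
    unfolding L_def by (rule smooth_on_has_derivative[OF o1(2)]) (use y d in auto)
  have K: "(?g has_derivative K) (at (?f y))"
    unfolding K_def by (rule smooth_on_has_derivative[OF o2(2) fy])
  have y': "y \<in> {x \<in> V. F x \<in> fst d}" using y d by auto
  have "(?g \<circ> ?f has_derivative K \<circ> L) (at y)" by (rule diff_chain_at[OF L K])
  then have "((\<lambda>x. x) has_derivative K \<circ> L) (at y)"
    by (rule has_derivative_transform_within_open[OF _ o1(1) y']) (rule gf)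
  then have KL: "K \<circ> L = (\<lambda>x. x)" using has_derivative_unique has_derivative_ident by blast
  have "(?f has_derivative L) (at (?g (?f y)))" using L gf[OF y'] by (metis comp_apply)
  then have "(?f \<circ> ?g has_derivative L \<circ> K) (at (?f y))" by (rule diff_chain_at[OF K])
  then have "((\<lambda>x. x) has_derivative L \<circ> K) (at (?f y))"
    by (rule has_derivative_transform_within_open[OF _ o2(1) fy]) (rule fg)
  then have LK: "L \<circ> K = (\<lambda>x. x)" using has_derivative_unique has_derivative_ident by blast
  show ?thesis
    using that[of L K] L K KL LK by (auto simp: fun_eq_iff has_derivative_bounded_linear)
qed

lemma local_param_linear_change:
  assumes "charted M" "local_param M V F D \<psi>"
    and "bounded_linear L" "bounded_linear K" "\<And>x. K (L x) = x" "\<And>y. L (K y) = y"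
  shows "local_param M (L ` V) (F \<circ> K) D (L \<circ> \<psi>)"
proof -
  have D: "openin (mtop M) D" and V: "open V"
    and \<psi>: "smooth_map (open_submfd M D) (open_euclidean V) \<psi>"
    and F: "smooth_map (open_euclidean V) M F"
    and inv: "F ` V \<subseteq> D" "\<And>p. p \<in> D \<Longrightarrow> F (\<psi> p) = p" "\<And>y. y \<in> V \<Longrightarrow> \<psi> (F y) = y"
    using assms(2) by (auto simp: local_param_def)
  have "L ` V = K -` V" using assms(5,6) by (auto simp: image_iff) metis
  then have LV: "open (L ` V)"
    using open_vimage[OF V, of K] linear_continuous_on[OF assms(4)] by simp
  have sL: "smooth_map (open_euclidean V) (open_euclidean (L ` V)) L"
    by (rule smooth_map_open_euclideanI[OF V _ smooth_on_linear[OF V assms(3)]]) auto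
  have sK: "smooth_map (open_euclidean (L ` V)) (open_euclidean V) K"
    by (rule smooth_map_open_euclideanI[OF LV _ smooth_on_linear[OF LV assms(4)]]) (auto simp: assms)
  have "smooth_map (open_submfd M D) (open_euclidean (L ` V)) (L \<circ> \<psi>)"
    by (rule smooth_map_compose[OF _ _ _ \<psi> sL])
      (auto intro: charted_open_submfd charted_open_euclidean assms D V LV)
  moreover have "smooth_map (open_euclidean (L ` V)) M (F \<circ> K)"
    by (rule smooth_map_compose[OF _ _ _ sK F])
      (auto intro: charted_open_euclidean assms V LV)
  ultimately show ?thesis
    using inv D LV assms(5,6) by (auto simp: local_param_def)
qed


section \<open>Local coordinates on a principal circle bundle\<close>

text \<open>Coordinates adapted to the bundle and to a chart \<open>c\<close> of the base. Let \<open>\<Phi>\<close> be a local trivialization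
  around the fibre of \<open>a\<close> and \<open>w\<close> the circle component of \<open>\<Phi> a\<close>. The parametrization sends \<open>(y, t)\<close> to
  the point over \<open>c\<^sup>-\<^sup>1 y\<close> whose circle component is \<open>w cis t\<close>. In these coordinates \<open>\<pi>\<close> is the first
  projection, and by equivariance of \<open>\<Phi>\<close> the action moves \<open>a\<close> along the second coordinate. Smoothness
  of the sub-bundle over a submanifold, existence of lifts of curves, and the
  coordinates of the generator are all read off from here.\<close>

lemma bundle_local_param:
  fixes P :: "('p, 'f::euclidean_space) mfd" and M :: "('m, 'e::euclidean_space) mfd"
  assumes pcb: "principal_circle_bundle P M \<pi> act"
    and a: "a \<in> points P" and c: "c \<in> maximal_atlas M" "\<pi> a \<in> fst c"
  obtains V F D G where "open V" "V \<subseteq> snd c ` fst c" "snd c (\<pi> a) \<in> V" "a \<in> D"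
    "local_param P (V \<times> {-pi<..<pi}) F D G"
    "\<And>y t. y \<in> V \<Longrightarrow> t \<in> {-pi<..<pi} \<Longrightarrow> \<pi> (F (y, t)) = chart_inv c y"
    "\<And>p. p \<in> D \<Longrightarrow> \<pi> p \<in> fst c \<and> fst (G p) = snd c (\<pi> p)"
    "\<And>t. t \<in> {-pi<..<pi} \<Longrightarrow> F (snd c (\<pi> a), t) = act a (cis t)"
proof -
  have cP: "charted P" and cM: "charted M" and s\<pi>: "smooth_map P M \<pi>"
    and sact: "smooth_map (prod_mfd P circle_mfd) P (\<lambda>(a, z). act a z)"
    and act\<pi>: "\<And>z. z \<in> circle \<Longrightarrow> \<pi> (act a z) = \<pi> a"
    using pcb a smooth_manifold_charted unfolding principal_circle_bundle_def by blast+
  have \<pi>a: "\<pi> a \<in> points M" using smooth_map_in[OF s\<pi> a] .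
  have "\<exists>U \<Phi>. openin (mtop M) U \<and> \<pi> a \<in> U \<and>
      diffeomorphism (open_submfd P {a \<in> points P. \<pi> a \<in> U})
        (prod_mfd (open_submfd M U) circle_mfd) \<Phi> \<and>
      (\<forall>p\<in>points P. \<pi> p \<in> U \<longrightarrow> fst (\<Phi> p) = \<pi> p \<and>
        (\<forall>z\<in>circle. snd (\<Phi> (act p z)) = snd (\<Phi> p) * z))"
    using pcb unfolding principal_circle_bundle_def by (elim conjE) (erule bspec[OF _ \<pi>a])
  then obtain U \<Phi> where U: "openin (mtop M) U" "\<pi> a \<in> U"
    and diff: "diffeomorphism (open_submfd P {a \<in> points P. \<pi> a \<in> U})
        (prod_mfd (open_submfd M U) circle_mfd) \<Phi>"
    and triv: "\<And>p. p \<in> points P \<Longrightarrow> \<pi> p \<in> U \<Longrightarrow> fst (\<Phi> p) = \<pi> p \<and>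
        (\<forall>z\<in>circle. snd (\<Phi> (act p z)) = snd (\<Phi> p) * z)"
    by blast
  define A where "A = {a \<in> points P. \<pi> a \<in> U}"
  define Q where "Q = prod_mfd (open_submfd M U) circle_mfd"
  obtain g where s\<Phi>: "smooth_map (open_submfd P A) Q \<Phi>" and sg: "smooth_map Q (open_submfd P A) g"
    and "\<forall>p\<in>points (open_submfd P A). g (\<Phi> p) = p" and "\<forall>q\<in>points Q. \<Phi> (g q) = q"
    using diff unfolding diffeomorphism_def A_def Q_def by blast
  have ptsQ: "points Q = U \<times> circle"
    using openin_subset[OF U(1)] by (auto simp: Q_def)
  have ptsA: "points (open_submfd P A) = A" by (auto simp: A_def)
  have g\<Phi>: "g (\<Phi> p) = p" if "p \<in> A" for p
    using \<open>\<forall>p\<in>points (open_submfd P A). g (\<Phi> p) = p\<close> that ptsA by blast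
  have \<Phi>g: "\<Phi> (g q) = q" if "q \<in> U \<times> circle" for q
    using \<open>\<forall>q\<in>points Q. \<Phi> (g q) = q\<close> that ptsQ by blast
  have A: "openin (mtop P) A"
    unfolding A_def by (rule openin_continuous_map_preimage[OF smooth_map_continuous[OF s\<pi>] U(1)])
  have cA: "charted (open_submfd P A)" and cU: "charted (open_submfd M U)"
    using charted_open_submfd cP cM A U(1) by blast+
  have cQ: "charted Q" unfolding Q_def by (rule charted_prod_mfd[OF cU charted_circle_mfd])
  have \<Phi>in: "\<Phi> p \<in> U \<times> circle" if "p \<in> A" for p
    using smooth_map_in[OF s\<Phi>] that ptsA ptsQ by blast
  have gin: "g q \<in> A" if "q \<in> U \<times> circle" for q
    using smooth_map_in[OF sg] that ptsA ptsQ by blast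
  have fst\<Phi>: "fst (\<Phi> p) = \<pi> p" if "p \<in> A" for p
    using triv that unfolding A_def by blast
  have aA: "a \<in> A" using a U(2) by (simp add: A_def)
  define w where "w = snd (\<Phi> a)"
  have w: "w \<in> circle" using \<Phi>in[OF aA] unfolding w_def by (rule mem_Times_iff[THEN iffD1, THEN conjunct2])
  have ic: "is_chart (mtop M) c" using maximal_atlasD(1)[OF c(1)] .
  note cc = circle_chart_homeomorphic_maps[OF w]
  have cis_in: "w * cis t \<in> circle - {- w}" and Arg_cis_w: "Arg (w * cis t / w) = t"
    if "t \<in> {-pi<..<pi}" for t
    using cc that by (auto simp: homeomorphic_maps_def continuous_map_def Pi_iff)
  have Arg_in: "Arg (z / w) \<in> {-pi<..<pi}" and cis_Arg_w: "w * cis (Arg (z / w)) = z"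
    if "z \<in> circle - {- w}" for z
    using cc that by (auto simp: homeomorphic_maps_def continuous_map_def Pi_iff)
  let ?I = "{-pi<..<pi}"
  \<comment> \<open>Removing the antipode of \<open>w\<close> from each fibre makes the angle from \<open>w\<close> a coordinate.\<close>
  define V where "V = snd c ` (fst c \<inter> U)"
  define D where "D = {p \<in> A. \<pi> p \<in> fst c \<and> snd (\<Phi> p) \<noteq> - w}"
  define F where "F = (\<lambda>(y, t). g (chart_inv c y, w * cis t))"
  define G where "G = (\<lambda>p. (snd c (\<pi> p), Arg (snd (\<Phi> p) / w)))"
  have V: "open V"
    unfolding V_def by (intro open_chart_image[OF ic] openin_Int is_chart_openin ic U) auto
  have VU: "chart_inv c y \<in> fst c \<inter> U" "snd c (chart_inv c y) = y" if "y \<in> V" for y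
    using that ic by (auto simp: V_def)
  have W: "open (V \<times> ?I)" using V by (intro open_Times) auto
  have Fpt: "F (y, t) \<in> D" "\<pi> (F (y, t)) = chart_inv c y" "\<Phi> (F (y, t)) = (chart_inv c y, w * cis t)"
    if "y \<in> V" "t \<in> ?I" for y t
  proof -
    have q: "(chart_inv c y, w * cis t) \<in> U \<times> circle" using VU[OF that(1)] cis_in[OF that(2)] by auto
    show 1: "\<Phi> (F (y, t)) = (chart_inv c y, w * cis t)" using \<Phi>g[OF q] by (simp add: F_def)
    have 2: "F (y, t) \<in> A" using gin[OF q] by (simp add: F_def)
    show 3: "\<pi> (F (y, t)) = chart_inv c y" using fst\<Phi>[OF 2] 1 by simp
    show "F (y, t) \<in> D" using 1 2 3 VU[OF that(1)] cis_in[OF that(2)] by (simp add: D_def)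
  qed
  have Dpt: "snd (\<Phi> p) \<in> circle - {- w}" "\<Phi> p = (\<pi> p, snd (\<Phi> p))" "\<pi> p \<in> fst c \<inter> U" "p \<in> A"
    if "p \<in> D" for p
  proof -
    show A: "p \<in> A" using that by (simp add: D_def)
    show "\<Phi> p = (\<pi> p, snd (\<Phi> p))" using fst\<Phi>[OF A] by (metis prod.collapse)
    have "snd (\<Phi> p) \<in> circle" using \<Phi>in[OF A] by (rule mem_Times_iff[THEN iffD1, THEN conjunct2])
    then show "snd (\<Phi> p) \<in> circle - {- w}" using that by (simp add: D_def)
    show "\<pi> p \<in> fst c \<inter> U" using that by (simp add: D_def A_def)
  qed
  have s_snd: "smooth_map (open_submfd P A) circle_mfd (snd \<circ> \<Phi>)"
    using s\<Phi> unfolding Q_def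
    by (rule smooth_map_compose[OF cA charted_prod_mfd[OF cU charted_circle_mfd] charted_circle_mfd _
          smooth_map_snd[OF cU charted_circle_mfd]]) (auto simp: compatible_circle_chart)
  have D: "openin (mtop P) D"
  proof -
    have "openin (mtop (open_submfd P A)) {p \<in> points (open_submfd P A). (snd \<circ> \<Phi>) p \<in> fst (circle_chart w)}"
      by (rule openin_continuous_map_preimage[OF smooth_map_continuous[OF s_snd]
            is_chart_openin[OF is_chart_circle_chart[OF w]]])
    then have "openin (mtop P) {p \<in> points (open_submfd P A). (snd \<circ> \<Phi>) p \<in> fst (circle_chart w)}"
      using openin_trans_full[OF _ A] by simp
    moreover have "openin (mtop P) {p \<in> points P. \<pi> p \<in> fst c}"
      by (rule openin_continuous_map_preimage[OF smooth_map_continuous[OF s\<pi>] is_chart_openin[OF ic]])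
    ultimately have "openin (mtop P) ({p \<in> points P. \<pi> p \<in> fst c} \<inter>
        {p \<in> points (open_submfd P A). (snd \<circ> \<Phi>) p \<in> fst (circle_chart w)})" by blast
    moreover have "{p \<in> points P. \<pi> p \<in> fst c} \<inter>
        {p \<in> points (open_submfd P A). (snd \<circ> \<Phi>) p \<in> fst (circle_chart w)} = D"
      unfolding ptsA circle_chart_simps(1)[OF w] using Dpt(1) by (auto simp: D_def A_def)
    ultimately show ?thesis by simp
  qed
  have DA: "D \<subseteq> A" by (auto simp: D_def)
  have cD: "charted (open_submfd P D)" using charted_open_submfd[OF cP D] .
  have ptsD: "points (open_submfd P D) = D" using openin_subset[OF D] by auto
  have F: "smooth_map (open_euclidean (V \<times> ?I)) P F"
  proof -
    note cW = charted_open_euclidean[OF W]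
    have "smooth_map (open_euclidean (V \<times> ?I)) (open_euclidean (snd c ` fst c)) fst"
      by (rule smooth_map_open_euclideanI[OF W _ smooth_on_linear[OF W bounded_linear_fst]])
        (auto simp: V_def)
    from smooth_map_compose[OF cW charted_open_euclidean[OF is_chart_open_image[OF ic]] cM this
        maximal_chart_inv_smooth_map[OF cM c(1)]]
    have 1: "smooth_map (open_euclidean (V \<times> ?I)) (open_submfd M U) (chart_inv c \<circ> fst)"
      unfolding smooth_map_into_open_submfd_iff[OF cW] using VU by auto
    have "smooth_map (open_euclidean (V \<times> ?I)) (open_euclidean ?I) snd"
      by (rule smooth_map_open_euclideanI[OF W _ smooth_on_linear[OF W bounded_linear_snd]]) auto
    from smooth_map_compose[OF cW charted_open_euclidean charted_circle_mfd this]
      maximal_chart_inv_smooth_map[OF charted_circle_mfd circle_chart_maximal[OF w]]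
    have 2: "smooth_map (open_euclidean (V \<times> ?I)) circle_mfd (chart_inv (circle_chart w) \<circ> snd)"
      using circle_chart_simps(1,3)[OF w] by auto
    have "smooth_map (open_euclidean (V \<times> ?I)) P
        (g \<circ> (\<lambda>p. ((chart_inv c \<circ> fst) p, (chart_inv (circle_chart w) \<circ> snd) p)))"
      using smooth_map_compose[OF cW cQ cA
          smooth_map_Pair[OF cW cU charted_circle_mfd 1 2, folded Q_def] sg]
      unfolding smooth_map_into_open_submfd_iff[OF cW] by (rule conjunct1)
    then show ?thesis
      by (rule smooth_map_cong[OF cW cP])
        (auto simp: F_def circle_chart_simps(1)[OF w] circle_chart_simps(4)[OF w])
  qed
  have G: "smooth_map (open_submfd P D) (open_euclidean (V \<times> ?I)) G"
  proof -
    have "smooth_map (open_submfd P D) M \<pi>"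
      by (rule smooth_map_open_submfd[OF cP cM D s\<pi>])
    then have "smooth_map (open_submfd P D) (open_submfd M (fst c)) \<pi>"
      unfolding smooth_map_into_open_submfd_iff[OF cD] ptsD using Dpt(3) by auto
    from smooth_map_compose[OF cD charted_open_submfd[OF cM is_chart_openin[OF ic]]
        charted_open_euclidean[OF is_chart_open_image[OF ic]] this maximal_chart_smooth_map[OF cM c(1)]]
    have 1: "smooth_map (open_submfd P D) (open_euclidean V) (snd c \<circ> \<pi>)"
      unfolding smooth_map_to_open_euclidean_iff[OF cD] ptsD using Dpt(3) by (auto simp: V_def)
    have "smooth_map (open_submfd P D) circle_mfd (snd \<circ> \<Phi>)"
      using smooth_map_open_submfd[OF cA charted_circle_mfd _ s_snd, of D] D DA
      by (simp add: open_submfd_open_submfd openin_open_subtopology[OF A])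
    then have "smooth_map (open_submfd P D) (open_submfd circle_mfd (fst (circle_chart w))) (snd \<circ> \<Phi>)"
      unfolding smooth_map_into_open_submfd_iff[OF cD] ptsD circle_chart_simps(1)[OF w]
      using Dpt(1) by auto
    moreover have "smooth_map (open_submfd circle_mfd (fst (circle_chart w))) (open_euclidean ?I)
        (snd (circle_chart w))"
      using maximal_chart_smooth_map[OF charted_circle_mfd circle_chart_maximal[OF w]]
        circle_chart_simps(1,3)[OF w] by simp
    ultimately have 2: "smooth_map (open_submfd P D) (open_euclidean ?I)
        (snd (circle_chart w) \<circ> (snd \<circ> \<Phi>))"
      by (rule smooth_map_compose[OF cD charted_open_submfd[OF charted_circle_mfd
          is_chart_openin[OF is_chart_circle_chart[OF w]]]
          charted_open_euclidean[OF open_greaterThanLessThan]])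
    show ?thesis
      using smooth_map_open_euclidean_Pair[OF cD 1 2] by (simp add: G_def circle_chart_simps(2)[OF w])
  qed
  have lp: "local_param P (V \<times> ?I) F D G"
    unfolding local_param_def
  proof (intro conjI ballI D W G F)
    show "F ` (V \<times> ?I) \<subseteq> D" using Fpt(1) by blast
    show "F (G p) = p" if "p \<in> D" for p
      using cis_Arg_w[OF Dpt(1)[OF that]] Dpt[OF that] ic g\<Phi>[of p] by (simp add: F_def G_def)
    show "G (F y) = y" if "y \<in> V \<times> ?I" for y
    proof -
      obtain x t where "y = (x, t)" "x \<in> V" "t \<in> ?I"
        using \<open>y \<in> V \<times> ?I\<close> by blast
      then show ?thesis using Fpt[of x t] VU(2)[of x] Arg_cis_w[of t] by (simp add: G_def)
    qed
  qed
  have "a \<in> D" using aA c(2) w by (auto simp: D_def w_def[symmetric])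
  moreover have "F (snd c (\<pi> a), t) = act a (cis t)" if "t \<in> ?I" for t
  proof -
    have z: "cis t \<in> circle" by simp
    have "act a (cis t) \<in> points P"
      using smooth_map_in[OF sact, of "(a, cis t)"] a by simp
    then have act: "act a (cis t) \<in> A" using act\<pi>[OF z] U(2) by (simp add: A_def)
    have "\<Phi> (act a (cis t)) = (\<pi> a, w * cis t)"
      using fst\<Phi>[OF act] act\<pi>[OF z] triv[OF a U(2)] z w_def by (metis prod.collapse)
    then show ?thesis using g\<Phi>[OF act] ic c(2) by (simp add: F_def)
  qed
  ultimately show ?thesis
    using that[OF V _ _ _ lp] Fpt(2) Dpt(3) c(2) U(2) by (auto simp: V_def G_def)
qed


section \<open>Tangent vectors as velocities\<close>

lemma charts_atD: "c \<in> charts_at M p \<Longrightarrow> c \<in> atlas M" "c \<in> charts_at M p \<Longrightarrow> p \<in> fst c"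
  by (auto simp: charts_at_def)

lemma chart_at_charts_at:
  assumes "charted M" "p \<in> points M"
  shows "chart_at M p \<in> charts_at M p"
proof -
  obtain c where "c \<in> atlas M" "p \<in> fst c" using charted_cover[OF assms] .
  then have "c \<in> charts_at M p" by (simp add: charts_at_def)
  then show ?thesis unfolding chart_at_def by (rule someI)
qed

lemma transition_has_derivative:
  assumes "smooth_manifold M" "c \<in> charts_at M p" "d \<in> charts_at M p"
  shows "(transition c d has_derivative frechet_derivative (transition c d) (at (snd c p))) (at (snd c p))"
proof -
  have "compatible c d" using assms by (auto simp: smooth_manifold_def charts_at_def)
  then show ?thesis
    using assms(2,3) by (intro smooth_on_has_derivative[of "snd c ` (fst c \<inter> fst d)"])
      (auto simp: compatible_def charts_at_def)
qed

lemma tangent_space_eqI: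
  assumes "v \<in> tangent_space M p" "w \<in> tangent_space M p" "c \<in> charts_at M p" "v c = w c"
  shows "v = w"
proof
  fix d show "v d = w d"
  proof (cases "d \<in> charts_at M p")
    case True
    then have "v d = frechet_derivative (transition c d) (at (snd c p)) (v c)"
      "w d = frechet_derivative (transition c d) (at (snd c p)) (w c)"
      using assms(1-3) unfolding tangent_space_def by blast+
    then show ?thesis using assms(4) by simp
  next
    case False
    then have "v d = 0" "w d = 0" using assms(1,2) unfolding tangent_space_def by blast+
    then show ?thesis by simp
  qed
qed

lemma tangent_space_tv_comb:
  assumes "smooth_manifold M" "v \<in> tangent_space M p" "w \<in> tangent_space M p"
  shows "tv_comb r v s w \<in> tangent_space M p"
  unfolding tangent_space_def
proof (intro CollectI conjI ballI allI impI)
  fix c d assume c: "c \<in> charts_at M p" and d: "d \<in> charts_at M p"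
  let ?T = "frechet_derivative (transition c d) (at (snd c p))"
  interpret linear ?T
    using transition_has_derivative[OF assms(1) c d] by (rule has_derivative_linear)
  have "v d = ?T (v c)" "w d = ?T (w c)" using assms(2,3) c d unfolding tangent_space_def by blast+
  then show "r *\<^sub>R v d + s *\<^sub>R w d = ?T (r *\<^sub>R v c + s *\<^sub>R w c)"
    by (simp add: add scaleR)
next
  fix c assume "c \<notin> charts_at M p"
  then have "v c = 0" "w c = 0" using assms(2,3) unfolding tangent_space_def by blast+
  then show "r *\<^sub>R v c + s *\<^sub>R w c = 0" by simp
qed

lemma velocity_cong:
  fixes M :: "('m, 'e::euclidean_space) mfd"
  assumes "open T" "0 \<in> T" "\<And>t. t \<in> T \<Longrightarrow> \<gamma> t = \<delta> t"
  shows "velocity M \<gamma> 0 = velocity M \<delta> 0"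
proof -
  have "eventually (\<lambda>t. \<gamma> t = \<delta> t) (nhds 0)"
    using assms eventually_nhds by blast
  then have "vector_derivative (snd d \<circ> \<gamma>) (at 0) = vector_derivative (snd d \<circ> \<delta>) (at 0)" for d :: "('m, 'e) chart"
    by (intro vector_derivative_cong_eq) (auto elim: eventually_mono)
  moreover have "\<gamma> 0 = \<delta> 0" using assms by blast
  ultimately show ?thesis unfolding velocity_def by (simp only:)
qed

lemma open_symmetric_interval:
  fixes T :: "real set"
  assumes "open T" "0 \<in> T"
  obtains \<epsilon> where "0 < \<epsilon>" "{-\<epsilon><..<\<epsilon>} \<subseteq> T"
proof -
  obtain \<epsilon> where "0 < \<epsilon>" "ball 0 \<epsilon> \<subseteq> T" using openE[OF assms] .
  moreover have "ball (0::real) \<epsilon> = {-\<epsilon><..<\<epsilon>}" by (auto simp: dist_real_def)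
  ultimately show ?thesis using that by blast
qed

lemma has_vector_derivative_compose:
  "(f has_vector_derivative f') (at x) \<Longrightarrow> (g has_derivative g') (at (f x)) \<Longrightarrow>
    (g \<circ> f has_vector_derivative g' f') (at x)"
  by (rule vector_derivative_diff_chain_within) (auto intro: has_derivative_at_withinI)

lemma velocity_component:
  assumes "charted M" "0 < \<epsilon>" "smooth_map (open_euclidean {-\<epsilon><..<\<epsilon>}) M \<gamma>" "c \<in> charts_at M (\<gamma> 0)"
  shows "(snd c \<circ> \<gamma> has_vector_derivative velocity M \<gamma> 0 c) (at 0)"
proof -
  note o = smooth_map_from_open_euclideanD[OF _ assms(1,3) charts_atD(1)[OF assms(4)]]
  have "(snd c \<circ> \<gamma> has_derivative frechet_derivative (snd c \<circ> \<gamma>) (at 0)) (at 0)"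
    by (rule smooth_on_has_derivative[OF o(2)]) (use assms(2) charts_atD(2)[OF assms(4)] in auto)
  then have "snd c \<circ> \<gamma> differentiable at 0" by (rule differentiableI)
  then show ?thesis using assms(4) by (simp add: vector_derivative_works velocity_def)
qed

text \<open>The chain rule behind the next results: \<open>h\<close> is the expression of \<open>k\<close> in the chart \<open>c\<close>. It is applied
  to the coordinate maps of other charts, and to such maps preceded by a smooth map of manifolds.\<close>

lemma velocity_chain:
  assumes "charted M" "0 < \<epsilon>" "smooth_map (open_euclidean {-\<epsilon><..<\<epsilon>}) M \<gamma>" "c \<in> charts_at M (\<gamma> 0)"
    and "(h has_derivative H) (at (snd c (\<gamma> 0)))" "\<And>p. p \<in> fst c \<Longrightarrow> h (snd c p) = k p"
  shows "(k \<circ> \<gamma> has_vector_derivative H (velocity M \<gamma> 0 c)) (at 0)"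
proof -
  have "(h \<circ> (snd c \<circ> \<gamma>) has_vector_derivative H (velocity M \<gamma> 0 c)) (at 0)"
    by (rule has_vector_derivative_compose[OF velocity_component[OF assms(1-4)]]) (use assms(5) in simp)
  moreover have "open {x \<in> {-\<epsilon><..<\<epsilon>}. \<gamma> x \<in> fst c}"
    using smooth_map_from_open_euclideanD(1)[OF _ assms(1,3) charts_atD(1)[OF assms(4)]] by simp
  ultimately show ?thesis
    by (rule has_vector_derivative_transform_within_open) (use assms(2,6) charts_atD(2)[OF assms(4)] in auto)
qed

lemma velocity_in_tangent_space:
  assumes "smooth_manifold M" "0 < \<epsilon>" "smooth_map (open_euclidean {-\<epsilon><..<\<epsilon>}) M \<gamma>"
  shows "velocity M \<gamma> 0 \<in> tangent_space M (\<gamma> 0)"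
  unfolding tangent_space_def
proof (intro CollectI conjI ballI allI impI)
  fix c d assume c: "c \<in> charts_at M (\<gamma> 0)" and d: "d \<in> charts_at M (\<gamma> 0)"
  have "charted M" using smooth_manifold_charted assms by blast
  have "(snd d \<circ> \<gamma> has_vector_derivative
      frechet_derivative (transition c d) (at (snd c (\<gamma> 0))) (velocity M \<gamma> 0 c)) (at 0)"
  proof (rule velocity_chain[OF \<open>charted M\<close> assms(2,3) c transition_has_derivative[OF assms(1) c d]])
    show "transition c d (snd c p) = snd d p" if "p \<in> fst c" for p
      using charted_is_chart[OF \<open>charted M\<close> charts_atD(1)[OF c]] that by (simp add: transition_def)
  qed
  then show "velocity M \<gamma> 0 d = frechet_derivative (transition c d) (at (snd c (\<gamma> 0))) (velocity M \<gamma> 0 c)"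
    using velocity_component[OF \<open>charted M\<close> assms(2,3) d] vector_derivative_at by metis
qed (simp add: velocity_def)

lemma smooth_map_coordinate_derivative:
  assumes "charted M" "charted N" "smooth_map M N f" "c \<in> charts_at M p" "d \<in> charts_at N (f p)"
  shows "(snd d \<circ> f \<circ> chart_inv c has_derivative
    frechet_derivative (snd d \<circ> f \<circ> chart_inv c) (at (snd c p))) (at (snd c p))"
  by (rule smooth_on_has_derivative[OF smooth_mapD[OF assms(3)]]) 
    (use charts_atD[OF assms(4)] charts_atD[OF assms(5)] in auto)

lemma differential_velocity:
  assumes "charted M" "charted N" "smooth_map M N f"
    and "0 < \<epsilon>" "smooth_map (open_euclidean {-\<epsilon><..<\<epsilon>}) M \<gamma>"
  shows "differential M N f (\<gamma> 0) (velocity M \<gamma> 0) = velocity N (f \<circ> \<gamma>) 0"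
proof
  fix d
  let ?c = "chart_at M (\<gamma> 0)"
  have "\<gamma> 0 \<in> points M" using smooth_map_in[OF assms(5)] assms(4) by simp
  then have c: "?c \<in> charts_at M (\<gamma> 0)" by (rule chart_at_charts_at[OF assms(1)])
  show "differential M N f (\<gamma> 0) (velocity M \<gamma> 0) d = velocity N (f \<circ> \<gamma>) 0 d"
  proof (cases "d \<in> charts_at N (f (\<gamma> 0))")
    case True
    have "((snd d \<circ> f) \<circ> \<gamma> has_vector_derivative
        frechet_derivative (snd d \<circ> f \<circ> chart_inv ?c) (at (snd ?c (\<gamma> 0))) (velocity M \<gamma> 0 ?c)) (at 0)"
    proof (rule velocity_chain[OF assms(1,4,5) c smooth_map_coordinate_derivative[OF assms(1-3) c True]])
      show "(snd d \<circ> f \<circ> chart_inv ?c) (snd ?c p) = (snd d \<circ> f) p" if "p \<in> fst ?c" for p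
        using charted_is_chart[OF assms(1) charts_atD(1)[OF c]] that by simp
    qed
    from vector_derivative_at[OF this] show ?thesis
      using True by (simp add: differential_def velocity_def Let_def comp_assoc)
  qed (simp add: differential_def velocity_def Let_def)
qed

lemma differential_tv_comb:
  assumes "charted M" "charted N" "smooth_map M N f" "p \<in> points M"
  shows "differential M N f p (tv_comb r v s w) =
    tv_comb r (differential M N f p v) s (differential M N f p w)"
proof
  fix d
  let ?c = "chart_at M p"
  have c: "?c \<in> charts_at M p" using chart_at_charts_at[OF assms(1,4)] .
  show "differential M N f p (tv_comb r v s w) d =
      tv_comb r (differential M N f p v) s (differential M N f p w) d"
  proof (cases "d \<in> charts_at N (f p)")
    case True
    interpret linear "frechet_derivative (snd d \<circ> f \<circ> chart_inv ?c) (at (snd ?c p))"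
      using smooth_map_coordinate_derivative[OF assms(1-3) c True] by (rule has_derivative_linear)
    show ?thesis using True by (simp add: differential_def Let_def add scaleR)
  qed (simp add: differential_def Let_def)
qed

text \<open>Straight lines in a chart provide the curves. Together with \<open>differential_velocity\<close> this
  reduces statements on differentials to statements on curves.\<close>

lemma tangent_vector_is_velocity:
  assumes "smooth_manifold M" "x \<in> points M" "v \<in> tangent_space M x"
  obtains \<gamma> \<epsilon> where "0 < \<epsilon>" "smooth_map (open_euclidean {-\<epsilon><..<\<epsilon>}) M \<gamma>" "\<gamma> 0 = x" "velocity M \<gamma> 0 = v"
proof -
  have M: "charted M" using smooth_manifold_charted[OF assms(1)] .
  obtain c where c: "c \<in> charts_at M x" using chart_at_charts_at[OF M assms(2)] ..
  have ic: "is_chart (mtop M) c" and cm: "c \<in> maximal_atlas M"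
    using c M charts_atD charted_is_chart atlas_maximal[OF assms(1)] by metis+
  define l where "l = (\<lambda>t. snd c x + t *\<^sub>R v c)"
  have l: "(l has_derivative (\<lambda>t. t *\<^sub>R v c)) (at t)" for t
    unfolding l_def by (auto intro!: derivative_eq_intros)
  have "continuous_on UNIV l" unfolding l_def by (intro continuous_intros)
  then have "open (l -` (snd c ` fst c))" using open_vimage is_chart_open_image[OF ic] by blast
  moreover have "0 \<in> l -` (snd c ` fst c)" using charts_atD(2)[OF c] by (simp add: l_def)
  ultimately obtain \<epsilon> where e: "0 < \<epsilon>" "{-\<epsilon><..<\<epsilon>} \<subseteq> l -` (snd c ` fst c)"
    by (rule open_symmetric_interval)
  define \<gamma> where "\<gamma> = chart_inv c \<circ> l"
  have "smooth_map (open_euclidean {-\<epsilon><..<\<epsilon>}) (open_euclidean (snd c ` fst c)) l"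
    by (rule smooth_map_open_euclideanI[OF _ _ smooth_on_constant_derivative[OF _ l]]) (use e in auto)
  then have \<gamma>: "smooth_map (open_euclidean {-\<epsilon><..<\<epsilon>}) M \<gamma>"
    unfolding \<gamma>_def
    by (intro smooth_map_compose[OF _ charted_open_euclidean[OF is_chart_open_image[OF ic]] M _
          maximal_chart_inv_smooth_map[OF M cm]] charted_open_euclidean) auto
  have \<gamma>0: "\<gamma> 0 = x" using ic charts_atD(2)[OF c] by (simp add: \<gamma>_def l_def)
  have "(l has_vector_derivative v c) (at 0)" using l by (simp add: has_vector_derivative_def)
  then have "(snd c \<circ> \<gamma> has_vector_derivative v c) (at 0)"
    by (rule has_vector_derivative_transform_within_open[of _ _ _ "{-\<epsilon><..<\<epsilon>}"])
      (use e in \<open>auto simp: \<gamma>_def f_inv_into_f\<close>)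
  then have "velocity M \<gamma> 0 c = v c"
    using c \<gamma>0 by (simp add: velocity_def vector_derivative_at)
  then have "velocity M \<gamma> 0 = v"
    using tangent_space_eqI velocity_in_tangent_space[OF assms(1) e(1) \<gamma>] \<gamma>0 assms(3) c by metis
  then show ?thesis using that e \<gamma> \<gamma>0 by blast
qed


section \<open>Preimages of submanifolds and horizontal lifts\<close>

text \<open>If \<open>\<Lambda>\<close> is cut out in the chart \<open>c\<close> by the subspace \<open>S\<close>, its preimage is cut out in the adapted
  coordinates by \<open>S \<times> \<real>\<close>.\<close>

lemma submanifold_preimage:
  fixes P :: "('p, 'f::euclidean_space) mfd" and M :: "('m, 'e::euclidean_space) mfd"
  assumes pcb: "principal_circle_bundle P M \<pi> act" and \<Lambda>: "submanifold M \<Lambda>"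
  shows "submanifold P {a \<in> points P. \<pi> a \<in> \<Lambda>}"
proof -
  have cP: "charted P"
    using pcb smooth_manifold_charted unfolding principal_circle_bundle_def by blast
  obtain k where k: "\<forall>x\<in>\<Lambda>. \<exists>c\<in>maximal_atlas M. \<exists>S. x \<in> fst c \<and> subspace S \<and> dim S = k \<and>
      snd c ` (fst c \<inter> \<Lambda>) = snd c ` fst c \<inter> S"
    using \<Lambda> unfolding submanifold_def by (elim conjE exE) (rule that)
  let ?Y = "{a \<in> points P. \<pi> a \<in> \<Lambda>}"
  have "\<exists>d\<in>maximal_atlas P. \<exists>T. a \<in> fst d \<and> subspace T \<and> dim T = k + 1 \<and>
      snd d ` (fst d \<inter> ?Y) = snd d ` fst d \<inter> T" if "a \<in> ?Y" for a
  proof -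
    have a: "a \<in> points P" "\<pi> a \<in> \<Lambda>" using that by auto
    obtain c S where c: "c \<in> maximal_atlas M" "\<pi> a \<in> fst c" and S: "subspace S" "dim S = k"
      and slice: "snd c ` (fst c \<inter> \<Lambda>) = snd c ` fst c \<inter> S"
      using bspec[OF k a(2)] by blast
    obtain V F D G where V: "snd c (\<pi> a) \<in> V" and D: "a \<in> D"
      and lp: "local_param P (V \<times> {-pi<..<pi}) F D G"
      and G: "\<And>p. p \<in> D \<Longrightarrow> \<pi> p \<in> fst c \<and> fst (G p) = snd c (\<pi> p)"
      by (rule bundle_local_param[OF pcb a(1) c]) (rule that)
    have "(snd c (\<pi> a), 0) \<in> V \<times> {-pi<..<pi}" using V by simp
    then have "V \<times> {-pi<..<pi} \<noteq> {}" by blast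
    then obtain L :: "'e \<times> real \<Rightarrow> 'f" and K where LK: "bounded_linear L" "bounded_linear K"
      "\<And>x. K (L x) = x" "\<And>y. L (K y) = y"
      by (rule local_param_linear_iso[OF cP lp]) (rule that)
    define T where "T = L ` (S \<times> UNIV)"
    have lin: "linear L" using LK(1) by (rule bounded_linear.linear)
    have inj: "inj L" using LK(3) by (metis injI)
    have sub: "subspace (S \<times> (UNIV :: real set))" using S(1) by (rule subspace_Times) auto
    have T: "subspace T" unfolding T_def by (rule linear_subspace_image[OF lin sub])
    have "dim T = dim (S \<times> (UNIV :: real set))"
      unfolding T_def using inj_on_subset[OF inj] by (intro dim_image_eq[OF lin]) auto
    also have "\<dots> = k + 1" using S by (simp add: dim_Times)
    finally have dimT: "dim T = k + 1" .
    have "(D, L \<circ> G) \<in> maximal_atlas P"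
      by (rule local_param_maximal_atlas[OF cP local_param_linear_change[OF cP lp LK]])
    moreover have "(L \<circ> G) ` (D \<inter> ?Y) = (L \<circ> G) ` D \<inter> T"
    proof -
      have "\<pi> p \<in> \<Lambda> \<longleftrightarrow> (L \<circ> G) p \<in> T" if "p \<in> D" for p
      proof -
        have "(L \<circ> G) p \<in> T \<longleftrightarrow> fst (G p) \<in> S"
          using inj unfolding T_def by (auto simp: inj_image_mem_iff mem_Times_iff)
        also have "\<dots> \<longleftrightarrow> snd c (\<pi> p) \<in> snd c ` (fst c \<inter> \<Lambda>)"
          using G[OF that] unfolding slice by auto
        also have "\<dots> \<longleftrightarrow> \<pi> p \<in> \<Lambda>"
          using G[OF that] is_chart_inj_on[OF maximal_atlasD(1)[OF c(1)]]
          by (auto dest: inj_onD)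
        finally show ?thesis by blast
      qed
      moreover have "D \<subseteq> points P" using lp openin_subset unfolding local_param_def by blast
      ultimately show ?thesis by blast
    qed
    ultimately show ?thesis using D T dimT by (intro bexI[of _ "(D, L \<circ> G)"] exI[of _ T]) auto
  qed
  then show ?thesis unfolding submanifold_def by blast
qed

text \<open>In adapted coordinates, with \<open>\<eta>\<close> the coordinate expression of \<open>\<gamma>\<close>, the curves
  \<open>t \<mapsto> (\<eta> t, 2 * pi * s * t)\<close> lift \<open>\<gamma>\<close>. The second coordinate adds \<open>s\<close> times the generator of the action to the
  velocity at \<open>0\<close>, and \<open>\<alpha>\<close> takes the value \<open>1\<close> on the generator; so a suitable \<open>s\<close> makes the velocity
  horizontal. The lift is horizontal at time \<open>0\<close> only, which suffices for tangent vectors.\<close>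

lemma horizontal_lift:
  fixes P :: "('p, 'f::euclidean_space) mfd" and M :: "('m, 'e::euclidean_space) mfd"
  assumes pcb: "principal_circle_bundle P M \<pi> act" and conn: "connection_form P act \<alpha>"
    and a: "a \<in> points P"
    and e: "0 < \<epsilon>" and \<gamma>: "smooth_map (open_euclidean {-\<epsilon><..<\<epsilon>}) M \<gamma>" and \<gamma>0: "\<gamma> 0 = \<pi> a"
  obtains \<delta> \<epsilon>' where "0 < \<epsilon>'" "\<epsilon>' \<le> \<epsilon>" "smooth_map (open_euclidean {-\<epsilon>'<..<\<epsilon>'}) P \<delta>" "\<delta> 0 = a"
    "\<And>t. t \<in> {-\<epsilon>'<..<\<epsilon>'} \<Longrightarrow> \<pi> (\<delta> t) = \<gamma> t" "\<alpha> a (velocity P \<delta> 0) = 0"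
proof -
  have sP: "smooth_manifold P" and sM: "smooth_manifold M" and s\<pi>: "smooth_map P M \<pi>"
    and act1: "act a 1 = a"
    using pcb a unfolding principal_circle_bundle_def by blast+
  have cP: "charted P" and cM: "charted M" using sP sM smooth_manifold_charted by blast+
  obtain c where c: "c \<in> charts_at M (\<pi> a)" using chart_at_charts_at[OF cM smooth_map_in[OF s\<pi> a]] ..
  have cm: "c \<in> maximal_atlas M" using atlas_maximal[OF sM charts_atD(1)[OF c]] .
  have ic: "is_chart (mtop M) c" using maximal_atlasD(1)[OF cm] .
  let ?I = "{-pi<..<pi}"
  obtain V F D G where V: "open V" "snd c (\<pi> a) \<in> V"
    and lp: "local_param P (V \<times> ?I) F D G"
    and \<pi>F: "\<And>y t. y \<in> V \<Longrightarrow> t \<in> ?I \<Longrightarrow> \<pi> (F (y, t)) = chart_inv c y"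
    and Fact: "\<And>t. t \<in> ?I \<Longrightarrow> F (snd c (\<pi> a), t) = act a (cis t)"
    by (rule bundle_local_param[OF pcb a cm charts_atD(2)[OF c]]) (rule that)
  define y0 where "y0 = snd c (\<pi> a)"
  have W: "open (V \<times> ?I)" and F: "smooth_map (open_euclidean (V \<times> ?I)) P F"
    using lp unfolding local_param_def by blast+
  have F0: "F (y0, 0) = a" using Fact[of 0] act1 by (simp add: y0_def)
  obtain d where d: "d \<in> charts_at P a" using chart_at_charts_at[OF cP a] ..
  define H where "H = frechet_derivative (snd d \<circ> F) (at (y0, 0))"
  have H: "(snd d \<circ> F has_derivative H) (at (y0, 0))"
    unfolding H_def
    by (rule smooth_on_has_derivative[OF smooth_map_from_open_euclideanD(2)[OF W cP F charts_atD(1)[OF d]]])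
      (use V F0 charts_atD(2)[OF d] in \<open>auto simp: y0_def\<close>)
  interpret H: linear H using H by (rule has_derivative_linear)
  have vel: "smooth_map (open_euclidean {-e<..<e}) P (F \<circ> \<kappa>)"
    "velocity P (F \<circ> \<kappa>) 0 \<in> tangent_space P a" "velocity P (F \<circ> \<kappa>) 0 d = H q"
    if "0 < e" "\<kappa> 0 = (y0, 0)" "(\<kappa> has_vector_derivative q) (at 0)"
      "smooth_on {-e<..<e} \<kappa>" "\<kappa> ` {-e<..<e} \<subseteq> V \<times> ?I" for e \<kappa> q
  proof -
    show s: "smooth_map (open_euclidean {-e<..<e}) P (F \<circ> \<kappa>)"
      using that by (intro smooth_map_compose[OF _ charted_open_euclidean[OF W] cP _ F]
          smooth_map_open_euclideanI charted_open_euclidean) auto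
    have 0: "(F \<circ> \<kappa>) 0 = a" using that(2) F0 by simp
    then show "velocity P (F \<circ> \<kappa>) 0 \<in> tangent_space P a"
      using velocity_in_tangent_space[OF sP that(1) s] by metis
    have "((snd d \<circ> F) \<circ> \<kappa> has_vector_derivative H q) (at 0)"
      by (rule has_vector_derivative_compose[OF that(3)]) (use H in \<open>simp only: that(2)\<close>)
    then show "velocity P (F \<circ> \<kappa>) 0 d = H q"
      using vector_derivative_at d 0 unfolding velocity_def comp_assoc by simp
  qed
  define gen where "gen = generator P act a"
  have gen: "gen \<in> tangent_space P a" "gen d = H (0, 2 * pi)"
  proof -
    \<comment> \<open>One full turn takes time \<open>1\<close>, so the angle stays in its range for \<open>\<bar>t\<bar> < 1/2\<close>.\<close>
    define \<kappa> where "\<kappa> = (\<lambda>t::real. (y0, 2 * pi * t))"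
    have \<kappa>: "(\<kappa> has_derivative (\<lambda>t. (0, 2 * pi * t))) (at t)" for t
      unfolding \<kappa>_def by (auto intro!: derivative_eq_intros)
    have I: "2 * pi * t \<in> ?I" if "t \<in> {-(1/2)<..<1/2}" for t
    proof -
      have "-1 < 2 * t" "2 * t < 1" using that by auto
      then have "pi * (-1) < pi * (2 * t)" "pi * (2 * t) < pi * 1"
        using pi_gt_zero mult_strict_left_mono by blast+
      then show ?thesis by (simp add: mult_ac)
    qed
    have "(\<kappa> has_vector_derivative (0, 2 * pi)) (at 0)"
      using \<kappa> by (simp add: has_vector_derivative_def mult_ac)
    moreover have "smooth_on {-(1/2)<..<1/2} \<kappa>"
      by (rule smooth_on_constant_derivative[OF _ \<kappa>]) auto
    moreover have "\<kappa> ` {-(1/2)<..<1/2} \<subseteq> V \<times> ?I"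
      using V(2) I by (auto simp: \<kappa>_def y0_def)
    ultimately have v: "velocity P (F \<circ> \<kappa>) 0 \<in> tangent_space P a" "velocity P (F \<circ> \<kappa>) 0 d = H (0, 2 * pi)"
      using vel(2,3)[of "1/2" \<kappa>] by (auto simp: \<kappa>_def)
    have "gen = velocity P (F \<circ> \<kappa>) 0"
      unfolding gen_def generator_def
    proof (rule velocity_cong[of "{-(1/2)<..<1/2}"])
      show "act a (cis (2 * pi * t)) = (F \<circ> \<kappa>) t" if "t \<in> {-(1/2)<..<1/2}" for t
        using Fact[OF I[OF that]] by (simp add: \<kappa>_def y0_def)
    qed auto
    with v show "gen \<in> tangent_space P a" "gen d = H (0, 2 * pi)" by simp_all
  qed
  define \<eta> where "\<eta> = snd c \<circ> \<gamma>"
  define T where "T = {t \<in> {-\<epsilon><..<\<epsilon>}. \<gamma> t \<in> fst c}"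
  have oT: "open T" and sT: "smooth_on T \<eta>"
    unfolding T_def \<eta>_def
    using smooth_map_from_open_euclideanD[OF _ cM \<gamma> charts_atD(1)[OF c]] by auto
  have "c \<in> charts_at M (\<gamma> 0)" using c \<gamma>0 by simp
  from velocity_component[OF cM e \<gamma> this]
  have \<eta>': "(\<eta> has_vector_derivative velocity M \<gamma> 0 c) (at 0)" by (simp add: \<eta>_def)
  define \<kappa> where "\<kappa> = (\<lambda>s t::real. (\<eta> t, 2 * pi * s * t))"
  define q where "q = (\<lambda>s::real. (velocity M \<gamma> 0 c, 2 * pi * s))"
  \<comment> \<open>The interval depends on \<open>s\<close>, because the angle has to stay between \<open>-pi\<close> and \<open>pi\<close>.\<close>
  have curve: "\<exists>e>0. e \<le> \<epsilon> \<and> {-e<..<e} \<subseteq> T \<and> smooth_on {-e<..<e} (\<kappa> s) \<and> \<kappa> s ` {-e<..<e} \<subseteq> V \<times> ?I" for s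
  proof -
    have lin: "((\<lambda>t. 2 * pi * s * t) has_derivative (\<lambda>t. 2 * pi * s * t)) (at t)" for t
      by (auto intro!: derivative_eq_intros)
    have sm: "smooth_on T (\<kappa> s)"
      unfolding \<kappa>_def by (rule smooth_on_Pair[OF oT sT smooth_on_constant_derivative[OF oT lin]])
    have "open {t \<in> T. \<kappa> s t \<in> V \<times> ?I}"
      using continuous_open_preimage[OF smooth_on_imp_continuous_on[OF sm] oT W] by (simp add: Int_def vimage_def)
    moreover have "0 \<in> {t \<in> T. \<kappa> s t \<in> V \<times> ?I}"
      using e \<gamma>0 charts_atD(2)[OF c] V(2) by (auto simp: T_def \<kappa>_def \<eta>_def)
    ultimately obtain e where e: "0 < e" "{-e<..<e} \<subseteq> {t \<in> T. \<kappa> s t \<in> V \<times> ?I}"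
      by (rule open_symmetric_interval)
    let ?e = "min e \<epsilon>"
    have "{-?e<..<?e} \<subseteq> {-e<..<e}" by auto
    then have "{-?e<..<?e} \<subseteq> {t \<in> T. \<kappa> s t \<in> V \<times> ?I}" using e(2) by (rule order_trans)
    then show ?thesis
      using e(1) \<open>0 < \<epsilon>\<close> smooth_on_subset[OF sm, of "{-?e<..<?e}"]
      by (intro exI[of _ ?e]) auto
  qed
  have \<kappa>0: "\<kappa> s 0 = (y0, 0)" for s by (simp add: \<kappa>_def \<eta>_def y0_def \<gamma>0)
  have \<kappa>': "(\<kappa> s has_vector_derivative q s) (at 0)" for s
  proof -
    have "((\<lambda>t. 2 * pi * s * t) has_vector_derivative 2 * pi * s) (at 0)"
      by (auto intro!: derivative_eq_intros)
    then show ?thesis unfolding \<kappa>_def q_def by (rule has_vector_derivative_Pair[OF \<eta>'])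
  qed
  define v where "v = (\<lambda>s. velocity P (F \<circ> \<kappa> s) 0)"
  have v: "v s \<in> tangent_space P a" "v s d = H (q s)" for s
    using curve[of s] vel(2,3)[OF _ \<kappa>0 \<kappa>'] unfolding v_def by blast+
  define s where "s = - \<alpha> a (v 0)"
  have "v s = tv_comb 1 (v 0) s gen"
  proof (rule tangent_space_eqI[OF v(1) tangent_space_tv_comb[OF sP v(1) gen(1)] d])
    have "q s = q 0 + s *\<^sub>R (0, 2 * pi)" by (simp add: q_def)
    then show "v s d = 1 *\<^sub>R v 0 d + s *\<^sub>R gen d"
      by (simp add: v(2) gen(2) H.add H.scaleR del: scaleR_Pair)
  qed
  moreover have "\<alpha> a (tv_comb 1 (v 0) s gen) = 1 * \<alpha> a (v 0) + s * \<alpha> a gen"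
    using conn a v(1) gen(1) unfolding connection_form_def smooth_form1_def by blast
  moreover have "\<alpha> a gen = 1" using conn a unfolding connection_form_def gen_def by blast
  ultimately have \<alpha>: "\<alpha> a (v s) = 0" by (simp add: s_def)
  obtain e where e: "0 < e" "e \<le> \<epsilon>" "{-e<..<e} \<subseteq> T" "smooth_on {-e<..<e} (\<kappa> s)"
    "\<kappa> s ` {-e<..<e} \<subseteq> V \<times> ?I"
    using curve by blast
  show ?thesis
  proof (rule that[OF e(1,2) vel(1)[OF e(1) \<kappa>0 \<kappa>' e(4,5)]])
    show "(F \<circ> \<kappa> s) 0 = a" using \<kappa>0 F0 by simp
    show "\<alpha> a (velocity P (F \<circ> \<kappa> s) 0) = 0" using \<alpha> by (simp add: v_def)
    show "\<pi> ((F \<circ> \<kappa> s) t) = \<gamma> t" if "t \<in> {-e<..<e}" for t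
    proof -
      have "\<kappa> s t \<in> V \<times> ?I" "\<gamma> t \<in> fst c" using e that by (auto simp: T_def)
      then show ?thesis using \<pi>F[of "\<eta> t" "2 * pi * s * t"] ic by (simp add: \<kappa>_def \<eta>_def)
    qed
  qed
qed

lemma bundle_surjective:
  assumes "principal_circle_bundle P M \<pi> act" "x \<in> points M"
  obtains a where "a \<in> points P" "\<pi> a = x"
proof -
  have "\<exists>U \<Phi>. openin (mtop M) U \<and> x \<in> U \<and>
      diffeomorphism (open_submfd P {a \<in> points P. \<pi> a \<in> U})
        (prod_mfd (open_submfd M U) circle_mfd) \<Phi> \<and>
      (\<forall>p\<in>points P. \<pi> p \<in> U \<longrightarrow> fst (\<Phi> p) = \<pi> p \<and>
        (\<forall>z\<in>circle. snd (\<Phi> (act p z)) = snd (\<Phi> p) * z))"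
    using assms(1) unfolding principal_circle_bundle_def by (elim conjE) (erule bspec[OF _ assms(2)])
  then obtain U \<Phi> where x: "x \<in> U"
    and diff: "diffeomorphism (open_submfd P {a \<in> points P. \<pi> a \<in> U})
        (prod_mfd (open_submfd M U) circle_mfd) \<Phi>"
    and triv: "\<And>p. p \<in> points P \<Longrightarrow> \<pi> p \<in> U \<Longrightarrow> fst (\<Phi> p) = \<pi> p"
    by blast
  obtain g where g: "smooth_map (prod_mfd (open_submfd M U) circle_mfd)
      (open_submfd P {a \<in> points P. \<pi> a \<in> U}) g"
    and inv: "\<forall>q\<in>points (prod_mfd (open_submfd M U) circle_mfd). \<Phi> (g q) = q"
    using diff unfolding diffeomorphism_def by blast
  have q: "(x, 1) \<in> points (prod_mfd (open_submfd M U) circle_mfd)" using x assms(2) by simp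
  have "g (x, 1) \<in> points P" "\<pi> (g (x, 1)) \<in> U" using smooth_map_in[OF g q] by auto
  moreover have "\<Phi> (g (x, 1)) = (x, 1)" using inv q by blast
  ultimately show ?thesis using that[of "g (x, 1)"] triv by (metis fst_conv)
qed

lemma tangent_of_subset:
  assumes "smooth_manifold M"
  shows "tangent_of M Y x \<subseteq> tangent_space M x"
  using velocity_in_tangent_space[OF assms] unfolding tangent_of_def by blast

lemma differential_in_tangent_space:
  assumes "smooth_manifold M" "smooth_manifold N" "smooth_map M N f" "p \<in> points M" "v \<in> tangent_space M p"
  shows "differential M N f p v \<in> tangent_space N (f p)"
proof -
  have cM: "charted M" and cN: "charted N" using assms smooth_manifold_charted by blast+
  obtain \<gamma> \<epsilon> where e: "0 < \<epsilon>" and \<gamma>: "smooth_map (open_euclidean {-\<epsilon><..<\<epsilon>}) M \<gamma>" "\<gamma> 0 = p" "velocity M \<gamma> 0 = v"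
    using tangent_vector_is_velocity[OF assms(1,4,5)] .
  have "smooth_map (open_euclidean {-\<epsilon><..<\<epsilon>}) N (f \<circ> \<gamma>)"
    by (rule smooth_map_compose[OF charted_open_euclidean cM cN \<gamma>(1) assms(3)]) auto
  from velocity_in_tangent_space[OF assms(2) e this]
  show ?thesis using differential_velocity[OF cM cN assms(3) e \<gamma>(1)] \<gamma>(2,3) by simp
qed

lemma differential_tangent_of:
  assumes "charted M" "charted N" "smooth_map M N f" "f ` Y \<subseteq> Z" "v \<in> tangent_of M Y p"
  shows "differential M N f p v \<in> tangent_of N Z (f p)"
proof -
  obtain \<gamma> \<epsilon> where e: "0 < \<epsilon>" and \<gamma>: "smooth_map (open_euclidean {-\<epsilon><..<\<epsilon>}) M \<gamma>" "\<gamma> 0 = p"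
    "velocity M \<gamma> 0 = v" "\<gamma> ` {-\<epsilon><..<\<epsilon>} \<subseteq> Y"
    using assms(5) unfolding tangent_of_def by blast
  have "smooth_map (open_euclidean {-\<epsilon><..<\<epsilon>}) N (f \<circ> \<gamma>)"
    by (rule smooth_map_compose[OF charted_open_euclidean assms(1,2) \<gamma>(1) assms(3)]) auto
  moreover have "differential M N f p v = velocity N (f \<circ> \<gamma>) 0"
    using differential_velocity[OF assms(1-3) e \<gamma>(1)] \<gamma>(2,3) by simp
  moreover have "(f \<circ> \<gamma>) ` {-\<epsilon><..<\<epsilon>} \<subseteq> Z" "(f \<circ> \<gamma>) 0 = f p" using \<gamma>(2,4) assms(4) by auto
  ultimately show ?thesis using e unfolding tangent_of_def by blast
qed

text \<open>By linearity it suffices to consider the kernel. If \<open>d\<pi>\<close> annihilates \<open>z \<in> \<xi>\<^sub>a\<close>, then \<open>d\<alpha> = \<pi>\<^sup>*\<omega>\<close> gives \<open>d\<alpha>(z, u) = 0\<close> for all \<open>u \<in> \<xi>\<^sub>a\<close>, and \<open>d\<alpha>\<close> is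
  nondegenerate on \<open>\<xi>\<^sub>a\<close>.\<close>

lemma differential_inj_on_contact_plane:
  assumes preq: "prequantization M \<omega> P \<pi> act \<alpha>" and \<omega>: "smooth_form2 M \<omega>" and a: "a \<in> points P"
  shows "inj_on (differential P M \<pi> a) (contact_plane P \<alpha> a)"
proof (rule inj_onI)
  fix v w assume vw: "v \<in> contact_plane P \<alpha> a" "w \<in> contact_plane P \<alpha> a"
    and eq: "differential P M \<pi> a v = differential P M \<pi> a w"
  have sP: "smooth_manifold P" and sM: "smooth_manifold M" and s\<pi>: "smooth_map P M \<pi>"
    using preq unfolding prequantization_def principal_circle_bundle_def by blast+
  have cP: "charted P" and cM: "charted M" using sP sM smooth_manifold_charted by blast+
  have form: "smooth_form1 P \<alpha>" and nd: "nondegenerate_on (contact_plane P \<alpha> a) (ext_deriv1 P \<alpha> a)"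
    using preq a unfolding prequantization_def contact_form_def by blast+
  have d\<alpha>: "ext_deriv1 P \<alpha> a v w = \<omega> (\<pi> a) (differential P M \<pi> a v) (differential P M \<pi> a w)"
    if "v \<in> tangent_space P a" "w \<in> tangent_space P a" for v w
    using preq a that unfolding prequantization_def by blast
  have tvw: "v \<in> tangent_space P a" "w \<in> tangent_space P a" "\<alpha> a v = 0" "\<alpha> a w = 0"
    using vw unfolding contact_plane_def by blast+
  define z where "z = tv_comb 1 v (-1) w"
  have tz: "z \<in> tangent_space P a" unfolding z_def by (rule tangent_space_tv_comb[OF sP tvw(1,2)])
  have "\<alpha> a z = 1 * \<alpha> a v + (-1) * \<alpha> a w"
    using form a tvw(1,2) unfolding smooth_form1_def z_def by blast
  then have z: "z \<in> contact_plane P \<alpha> a" using tz tvw by (simp add: contact_plane_def)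
  have "ext_deriv1 P \<alpha> a z u = 0" if "u \<in> contact_plane P \<alpha> a" for u
  proof -
    have u: "u \<in> tangent_space P a" using that unfolding contact_plane_def by blast
    let ?d = "differential P M \<pi> a"
    have d: "?d v \<in> tangent_space M (\<pi> a)" "?d u \<in> tangent_space M (\<pi> a)"
      using differential_in_tangent_space[OF sP sM s\<pi> a] tvw(1) u by blast+
    have "?d z = tv_comb 1 (?d v) (-1) (?d v)"
      using differential_tv_comb[OF cP cM s\<pi> a, of 1 v "-1" w] unfolding z_def eq .
    then have "ext_deriv1 P \<alpha> a z u = \<omega> (\<pi> a) (tv_comb 1 (?d v) (-1) (?d v)) (?d u)"
      using d\<alpha>[OF tz u] by (simp only:)
    also have "\<dots> = 1 * \<omega> (\<pi> a) (?d v) (?d u) + (-1) * \<omega> (\<pi> a) (?d v) (?d u)"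
      using \<omega> smooth_map_in[OF s\<pi> a] d unfolding smooth_form2_def by blast
    finally show ?thesis by simp
  qed
  then have "z = tv_zero" using nd z unfolding nondegenerate_on_def by blast
  then show "v = w" unfolding z_def by (simp add: fun_eq_iff)
qed

lemma horizontal_vector_lift:
  assumes pcb: "principal_circle_bundle P M \<pi> act" and conn: "connection_form P act \<alpha>"
    and a: "a \<in> points P" and u: "u \<in> tangent_of M \<Lambda> (\<pi> a)"
  obtains v where "v \<in> tangent_of P {a \<in> points P. \<pi> a \<in> \<Lambda>} a" "v \<in> contact_plane P \<alpha> a"
    "differential P M \<pi> a v = u"
proof -
  have sP: "smooth_manifold P" and sM: "smooth_manifold M" and s\<pi>: "smooth_map P M \<pi>"
    using pcb unfolding principal_circle_bundle_def by blast+
  have cP: "charted P" and cM: "charted M" using sP sM smooth_manifold_charted by blast+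
  obtain \<gamma> \<epsilon> where e: "0 < \<epsilon>" and \<gamma>: "smooth_map (open_euclidean {-\<epsilon><..<\<epsilon>}) M \<gamma>" "\<gamma> 0 = \<pi> a"
    "velocity M \<gamma> 0 = u" "\<gamma> ` {-\<epsilon><..<\<epsilon>} \<subseteq> \<Lambda>"
    using u unfolding tangent_of_def by blast
  obtain \<delta> e' where \<delta>: "0 < e'" "e' \<le> \<epsilon>" "smooth_map (open_euclidean {-e'<..<e'}) P \<delta>" "\<delta> 0 = a"
    "\<And>t. t \<in> {-e'<..<e'} \<Longrightarrow> \<pi> (\<delta> t) = \<gamma> t" "\<alpha> a (velocity P \<delta> 0) = 0"
    by (rule horizontal_lift[OF pcb conn a e \<gamma>(1,2)]) (rule that)
  have "\<delta> t \<in> points P" if "t \<in> {-e'<..<e'}" for t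
    using smooth_map_in[OF \<delta>(3)] that by simp
  moreover have "\<pi> (\<delta> t) \<in> \<Lambda>" if "t \<in> {-e'<..<e'}" for t
    using \<delta>(2) \<delta>(5)[OF that] \<gamma>(4) that by auto
  ultimately have "\<delta> ` {-e'<..<e'} \<subseteq> {a \<in> points P. \<pi> a \<in> \<Lambda>}" by blast
  then have 1: "velocity P \<delta> 0 \<in> tangent_of P {a \<in> points P. \<pi> a \<in> \<Lambda>} a"
    using \<delta>(1,3,4) unfolding tangent_of_def by blast
  have "velocity P \<delta> 0 \<in> tangent_space P a"
    using velocity_in_tangent_space[OF sP \<delta>(1,3)] \<delta>(4) by simp
  then have 2: "velocity P \<delta> 0 \<in> contact_plane P \<alpha> a" using \<delta>(6) by (simp add: contact_plane_def)
  have "differential P M \<pi> a (velocity P \<delta> 0) = velocity M (\<pi> \<circ> \<delta>) 0"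
    using differential_velocity[OF cP cM s\<pi> \<delta>(1,3)] \<delta>(4) by simp
  also have "\<dots> = u"
    unfolding \<gamma>(3)[symmetric] by (rule velocity_cong[of "{-e'<..<e'}"]) (use \<delta> in auto)
  finally show ?thesis using that 1 2 by blast
qed

text \<open>Exhibits all tangent vectors of the base as tangent vectors of a submanifold, so that
  \<open>horizontal_vector_lift\<close> also yields the surjectivity of \<open>d\<pi>\<close> on the contact plane.\<close>

lemma tangent_of_points:
  assumes "smooth_manifold M" "x \<in> points M"
  shows "tangent_of M (points M) x = tangent_space M x"
proof
  show "tangent_space M x \<subseteq> tangent_of M (points M) x"
  proof
    fix v assume "v \<in> tangent_space M x"
    then obtain \<gamma> \<epsilon> where "0 < \<epsilon>" and \<gamma>: "smooth_map (open_euclidean {-\<epsilon><..<\<epsilon>}) M \<gamma>"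
      and "\<gamma> 0 = x" "velocity M \<gamma> 0 = v"
      by (rule tangent_vector_is_velocity[OF assms])
    moreover have "\<gamma> ` {-\<epsilon><..<\<epsilon>} \<subseteq> points M" using smooth_map_in[OF \<gamma>] by auto
    ultimately show "v \<in> tangent_of M (points M) x" unfolding tangent_of_def by blast
  qed
qed (rule tangent_of_subset[OF assms(1)])

text \<open>Under \<open>\<xi>\<^sub>a \<cong> T\<^sub>x M\<close> the horizontal part of the tangent space of the preimage corresponds to the tangent
  space of \<open>\<Lambda>\<close>. For the direction from right to left, a horizontal lift of \<open>d\<pi>(v)\<close> that is tangent to the preimage
  must coincide with \<open>v\<close>, since \<open>d\<pi>\<close> is injective on \<open>\<xi>\<^sub>a\<close>.\<close>

lemma tangent_of_preimage_iff:
  assumes preq: "prequantization M \<omega> P \<pi> act \<alpha>" and \<omega>: "smooth_form2 M \<omega>" and a: "a \<in> points P"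
    and v: "v \<in> contact_plane P \<alpha> a"
  shows "v \<in> tangent_of P {a \<in> points P. \<pi> a \<in> \<Lambda>} a \<longleftrightarrow>
    differential P M \<pi> a v \<in> tangent_of M \<Lambda> (\<pi> a)"
proof
  have pcb: "principal_circle_bundle P M \<pi> act" and conn: "connection_form P act \<alpha>"
    using preq unfolding prequantization_def by blast+
  have s\<pi>: "smooth_map P M \<pi>" and cP: "charted P" and cM: "charted M"
    using pcb smooth_manifold_charted unfolding principal_circle_bundle_def by blast+
  show "differential P M \<pi> a v \<in> tangent_of M \<Lambda> (\<pi> a)"
    if "v \<in> tangent_of P {a \<in> points P. \<pi> a \<in> \<Lambda>} a"
    by (rule differential_tangent_of[OF cP cM s\<pi> _ that]) auto
  assume "differential P M \<pi> a v \<in> tangent_of M \<Lambda> (\<pi> a)"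
  then obtain v' where v': "v' \<in> tangent_of P {a \<in> points P. \<pi> a \<in> \<Lambda>} a" "v' \<in> contact_plane P \<alpha> a"
    "differential P M \<pi> a v' = differential P M \<pi> a v"
    by (rule horizontal_vector_lift[OF pcb conn a])
  have "v' = v" by (rule inj_onD[OF differential_inj_on_contact_plane[OF preq \<omega> a] v'(3,2) v])
  then show "v \<in> tangent_of P {a \<in> points P. \<pi> a \<in> \<Lambda>} a" using v'(1) by simp
qed


section \<open>Coisotropic submanifolds\<close>

theorem proposition4p2:
  fixes M :: "('m, 'e::euclidean_space) mfd" and \<omega> :: "('m, 'e) form2"
    and P :: "('p, 'f::euclidean_space) mfd" and \<alpha> :: "('p, 'f) form1"
    and \<pi> :: "'p \<Rightarrow> 'm" and act :: "'p \<Rightarrow> complex \<Rightarrow> 'p" and \<Lambda> :: "'m set"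
  assumes "closed_manifold M" and "symplectic_form M \<omega>" and "integral_class M \<omega>"
    and "prequantization M \<omega> P \<pi> act \<alpha>"
    and "submanifold M \<Lambda>"
  shows "symplectic_coisotropic M \<omega> \<Lambda> \<longleftrightarrow>
         contact_coisotropic P \<alpha> {a \<in> points P. \<pi> a \<in> \<Lambda>}"
proof -
  let ?Y = "{a \<in> points P. \<pi> a \<in> \<Lambda>}"
  let ?d = "\<lambda>a. differential P M \<pi> a" and ?\<xi> = "\<lambda>a. contact_plane P \<alpha> a"
  have \<omega>: "smooth_form2 M \<omega>" using assms(2) unfolding symplectic_form_def by blast
  have pcb: "principal_circle_bundle P M \<pi> act" and conn: "connection_form P act \<alpha>"
    using assms(4) unfolding prequantization_def by blast+
  have sP: "smooth_manifold P" and sM: "smooth_manifold M" and s\<pi>: "smooth_map P M \<pi>"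
    using pcb unfolding principal_circle_bundle_def by blast+
  have \<Lambda>: "\<Lambda> \<subseteq> points M" using assms(5) unfolding submanifold_def by blast
  have Y: "submanifold P ?Y" by (rule submanifold_preimage[OF pcb assms(5)])
  have \<xi>T: "v \<in> tangent_space P a" if "v \<in> ?\<xi> a" for v a
    using that unfolding contact_plane_def by blast
  have dT: "?d a v \<in> tangent_space M (\<pi> a)" if "v \<in> ?\<xi> a" "a \<in> points P" for v a
    using differential_in_tangent_space[OF sP sM s\<pi> that(2) \<xi>T[OF that(1)]] .
  have d\<alpha>: "ext_deriv1 P \<alpha> a v w = \<omega> (\<pi> a) (?d a v) (?d a w)"
    if "v \<in> ?\<xi> a" "w \<in> ?\<xi> a" "a \<in> points P" for v w a
    using assms(4) that \<xi>T unfolding prequantization_def by blast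
  note tan = tangent_of_preimage_iff[OF assms(4) \<omega>, of _ _ \<Lambda>]
  \<comment> \<open>\<open>d\<pi>\<close> matches the two orthogonal complements: it turns \<open>d\<alpha>\<close> into \<open>\<omega>\<close>, and every vector tangent to
    \<open>\<Lambda>\<close> is the image of a horizontal vector tangent to the preimage.\<close>
  have orth: "v \<in> orth_in (?\<xi> a) (ext_deriv1 P \<alpha> a) (tangent_of P ?Y a \<inter> ?\<xi> a) \<longleftrightarrow>
      ?d a v \<in> orth_in (tangent_space M (\<pi> a)) (\<omega> (\<pi> a)) (tangent_of M \<Lambda> (\<pi> a))"
    if a: "a \<in> points P" and v: "v \<in> ?\<xi> a" for a v
  proof -
    have "(\<forall>w\<in>tangent_of P ?Y a \<inter> ?\<xi> a. ext_deriv1 P \<alpha> a v w = 0) \<longleftrightarrow>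
        (\<forall>u\<in>tangent_of M \<Lambda> (\<pi> a). \<omega> (\<pi> a) (?d a v) u = 0)"
    proof (intro iffI ballI)
      fix u assume *: "\<forall>w\<in>tangent_of P ?Y a \<inter> ?\<xi> a. ext_deriv1 P \<alpha> a v w = 0"
        and "u \<in> tangent_of M \<Lambda> (\<pi> a)"
      from this(2) obtain w where w: "w \<in> tangent_of P ?Y a" "w \<in> ?\<xi> a" "?d a w = u"
        by (rule horizontal_vector_lift[OF pcb conn a])
      show "\<omega> (\<pi> a) (?d a v) u = 0" using * w d\<alpha>[OF v w(2) a] by auto
    next
      fix w assume *: "\<forall>u\<in>tangent_of M \<Lambda> (\<pi> a). \<omega> (\<pi> a) (?d a v) u = 0"
        and w: "w \<in> tangent_of P ?Y a \<inter> ?\<xi> a"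
      then have "?d a w \<in> tangent_of M \<Lambda> (\<pi> a)" using tan[OF a] by blast
      then show "ext_deriv1 P \<alpha> a v w = 0" using * d\<alpha>[OF v _ a] w by auto
    qed
    then show ?thesis using v dT[OF v a] unfolding orth_in_def by blast
  qed
  have pointwise: "orth_in (?\<xi> a) (ext_deriv1 P \<alpha> a) (tangent_of P ?Y a \<inter> ?\<xi> a) \<subseteq> tangent_of P ?Y a \<inter> ?\<xi> a \<longleftrightarrow>
      orth_in (tangent_space M (\<pi> a)) (\<omega> (\<pi> a)) (tangent_of M \<Lambda> (\<pi> a)) \<subseteq> tangent_of M \<Lambda> (\<pi> a)"
    (is "?L \<subseteq> _ \<longleftrightarrow> ?R \<subseteq> _") if a: "a \<in> points P" for a
  proof (intro iffI subsetI)
    fix u assume sub: "?L \<subseteq> tangent_of P ?Y a \<inter> ?\<xi> a" and u: "u \<in> ?R"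
    have "u \<in> tangent_of M (points M) (\<pi> a)"
      using u tangent_of_points[OF sM smooth_map_in[OF s\<pi> a]] unfolding orth_in_def by blast
    then obtain v where v: "v \<in> ?\<xi> a" "?d a v = u"
      by (rule horizontal_vector_lift[OF pcb conn a])
    then have "v \<in> tangent_of P ?Y a" using orth[OF a v(1)] u sub by blast
    then show "u \<in> tangent_of M \<Lambda> (\<pi> a)" using tan[OF a v(1)] v(2) by simp
  next
    fix v assume sub: "?R \<subseteq> tangent_of M \<Lambda> (\<pi> a)" and v: "v \<in> ?L"
    then have "v \<in> ?\<xi> a" unfolding orth_in_def by blast
    then show "v \<in> tangent_of P ?Y a \<inter> ?\<xi> a" using orth[OF a] tan[OF a] v sub by blast
  qed
  show ?thesis
  proof
    assume "symplectic_coisotropic M \<omega> \<Lambda>"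
    then show "contact_coisotropic P \<alpha> ?Y"
      using Y pointwise unfolding symplectic_coisotropic_def contact_coisotropic_def by blast
  next
    assume C: "contact_coisotropic P \<alpha> ?Y"
    have "orth_in (tangent_space M x) (\<omega> x) (tangent_of M \<Lambda> x) \<subseteq> tangent_of M \<Lambda> x" if x: "x \<in> \<Lambda>" for x
    proof -
      obtain a where "a \<in> points P" "\<pi> a = x" using bundle_surjective[OF pcb] x \<Lambda> by blast
      then show ?thesis
        using C x pointwise[of a] unfolding contact_coisotropic_def by blast
    qed
    then show "symplectic_coisotropic M \<omega> \<Lambda>"
      using assms(5) unfolding symplectic_coisotropic_def by blast
  qed
qed
end
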